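(* Let $\mathbb{F}$ be a field of characteristic $>3$. Then $\mathfrak{sl}_3(\mathbb{F})$ has a COD if and only if $\mathbb{F}$ contains a primitive cube root of unity.
   Context: $\mathfrak{sl}_n(\mathbb{F})$ denotes the Lie algebra of $n\times n$ traceless matrices over $\mathbb{F}$. A Cartan subalgebra is a nilpotent self-normalizing subalgebra. A classical Cartan subalgebra of $\mathfrak{L}=\mathfrak{sl}_n(\mathbb{F})$ (with $\ell=\mathrm{char}\,\mathbb{F}$) is an abelian Cartan subalgebra $H$ such that: (a) $\mathfrak{L}=\bigoplus_\alpha \mathfrak{L}_\alpha$ with $\mathfrak{L}_\alpha=\{x: [x,h]=\alpha(h)x\ \forall h\in H\}$ over linear functionals $\alpha$ on $H$ (roots); (b) for each root $\alpha\ne0$, $[\mathfrak{L}_\alpha,\mathfrak{L}_{-\alpha}]$ is one-dimensional; (c) for roots $\alpha,\beta$ with $\beta\neq0$, not all $\alpha+k\beta$ ($1\le k\le \ell-1$) are roots. The Killing form is $K(A,B)=2n\,\mathrm{Tr}(AB)$. A COD of $\mathfrak{sl}_n(\mathbb{F})$ is a vector space decomposition $\mathfrak{sl}_n(\mathbb{F})=H_0\oplus\cdots\oplus H_n$ into classical Cartan subalgebras that are pairwise orthogonal with respect to $K$. *)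

theory Defs
  imports "HOL-Analysis.Analysis"
begin

definition lie :: "'a::field^3^3 \<Rightarrow> 'a^3^3 \<Rightarrow> 'a^3^3" where
  "lie A B = A ** B - B ** A"

definition smul :: "'a::field \<Rightarrow> 'a^3^3 \<Rightarrow> 'a^3^3" where
  "smul c A = (\<chi> i j. c * A $ i $ j)"

definition mtrace :: "'a::field^3^3 \<Rightarrow> 'a" where
  "mtrace A = (\<Sum>i\<in>UNIV. A $ i $ i)"

text \<open>Killing form of sl_n with n = 3: K(A,B) = 2n Tr(AB).\<close>
definition killing :: "'a::field^3^3 \<Rightarrow> 'a^3^3 \<Rightarrow> 'a" where
  "killing A B = of_nat (2 * 3) * mtrace (A ** B)"

definition sl3 :: "('a::field^3^3) set" where
  "sl3 = {A. mtrace A = 0}"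

definition fspan :: "('a::field^3^3) set \<Rightarrow> ('a^3^3) set" where
  "fspan S = {x. \<exists>T c. finite T \<and> T \<subseteq> S \<and> x = (\<Sum>t\<in>T. smul (c t) t)}"

definition subspace_of :: "('a::field^3^3) set \<Rightarrow> ('a^3^3) set \<Rightarrow> bool" where
  "subspace_of L V \<longleftrightarrow> V \<subseteq> L \<and> 0 \<in> V \<and> (\<forall>x\<in>V. \<forall>y\<in>V. x + y \<in> V)
     \<and> (\<forall>c. \<forall>x\<in>V. smul c x \<in> V)"

definition one_dim :: "('a::field^3^3) set \<Rightarrow> bool" where
  "one_dim V \<longleftrightarrow> (\<exists>v. v \<noteq> 0 \<and> V = range (\<lambda>c. smul c v))"

definition is_dsum :: "('a::field^3^3) set \<Rightarrow> 'i set \<Rightarrow> ('i \<Rightarrow> ('a^3^3) set) \<Rightarrow> bool" where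
  "is_dsum L I V \<longleftrightarrow> (\<forall>i\<in>I. subspace_of L (V i)) \<and>
     (\<forall>x\<in>L. \<exists>!f. (\<forall>i. f i \<in> (if i \<in> I then V i else {0})) \<and> finite {i. f i \<noteq> 0}
                  \<and> x = (\<Sum>i\<in>{i. f i \<noteq> 0}. f i))"

definition lie_subalg :: "('a::field^3^3) set \<Rightarrow> bool" where
  "lie_subalg H \<longleftrightarrow> subspace_of sl3 H \<and> (\<forall>x\<in>H. \<forall>y\<in>H. lie x y \<in> H)"

definition lie_abelian :: "('a::field^3^3) set \<Rightarrow> bool" where
  "lie_abelian H \<longleftrightarrow> (\<forall>x\<in>H. \<forall>y\<in>H. lie x y = 0)"

fun lcs :: "('a::field^3^3) set \<Rightarrow> nat \<Rightarrow> ('a^3^3) set" where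
  "lcs H 0 = H"
| "lcs H (Suc k) = fspan {lie x y | x y. x \<in> H \<and> y \<in> lcs H k}"

definition lie_nilpotent :: "('a::field^3^3) set \<Rightarrow> bool" where
  "lie_nilpotent H \<longleftrightarrow> (\<exists>k. lcs H k = {0})"

definition normalizer :: "('a::field^3^3) set \<Rightarrow> ('a^3^3) set" where
  "normalizer H = {x \<in> sl3. \<forall>h\<in>H. lie x h \<in> H}"

definition cartan :: "('a::field^3^3) set \<Rightarrow> bool" where
  "cartan H \<longleftrightarrow> lie_subalg H \<and> lie_nilpotent H \<and> normalizer H = H"

text \<open>Linear functionals on H, normalised to vanish outside H (so that they are
  uniquely determined as HOL functions).\<close>
definition lin_fun :: "('a::field^3^3) set \<Rightarrow> ('a^3^3 \<Rightarrow> 'a) \<Rightarrow> bool" where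
  "lin_fun H \<alpha> \<longleftrightarrow> (\<forall>x\<in>H. \<forall>y\<in>H. \<alpha> (x + y) = \<alpha> x + \<alpha> y)
     \<and> (\<forall>c. \<forall>x\<in>H. \<alpha> (smul c x) = c * \<alpha> x) \<and> (\<forall>x. x \<notin> H \<longrightarrow> \<alpha> x = 0)"

definition root_space :: "('a::field^3^3) set \<Rightarrow> ('a^3^3 \<Rightarrow> 'a) \<Rightarrow> ('a^3^3) set" where
  "root_space H \<alpha> = {x \<in> sl3. \<forall>h\<in>H. lie x h = smul (\<alpha> h) x}"

definition is_root :: "('a::field^3^3) set \<Rightarrow> ('a^3^3 \<Rightarrow> 'a) \<Rightarrow> bool" where
  "is_root H \<alpha> \<longleftrightarrow> lin_fun H \<alpha> \<and> root_space H \<alpha> \<noteq> {0}"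

definition classical_cartan :: "('a::field^3^3) set \<Rightarrow> bool" where
  "classical_cartan H \<longleftrightarrow> cartan H \<and> lie_abelian H
     \<and> is_dsum sl3 {\<alpha>. lin_fun H \<alpha>} (root_space H)
     \<and> (\<forall>\<alpha>. is_root H \<alpha> \<and> \<alpha> \<noteq> (\<lambda>_. 0) \<longrightarrow>
          one_dim (fspan {lie x y | x y. x \<in> root_space H \<alpha> \<and> y \<in> root_space H (\<lambda>h. - \<alpha> h)}))
     \<and> (\<forall>\<alpha> \<beta>. is_root H \<alpha> \<and> is_root H \<beta> \<and> \<beta> \<noteq> (\<lambda>_. 0) \<longrightarrow>
          \<not> (\<forall>k\<in>{1..CHAR('a) - 1}. is_root H (\<lambda>h. \<alpha> h + of_nat k * \<beta> h)))"

definition sl3_has_COD :: "'a::field itself \<Rightarrow> bool" where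
  "sl3_has_COD _ \<longleftrightarrow> (\<exists>H :: nat \<Rightarrow> ('a^3^3) set.
     (\<forall>i\<le>3. classical_cartan (H i))
     \<and> (\<forall>i\<le>3. \<forall>j\<le>3. i \<noteq> j \<longrightarrow> (\<forall>x\<in>H i. \<forall>y\<in>H j. killing x y = 0))
     \<and> is_dsum sl3 {0..3} H)"

end

theory Submission
  imports Defs
begin

text \<open>
  A classical Cartan subalgebra \<open>H\<close> is the torus of traceless matrices that are diagonal in some
  basis over the ground field. Indeed, a root vector for a nonzero root is nilpotent, so it or its
  square has rank one, and the image of that rank one matrix is a common eigenvector \<open>v\<close> of \<open>H\<close>;
  root vectors map common eigenvectors to common eigenvectors, and \<open>sl3\<close> together with the scalars
  moves \<open>v\<close> everywhere.

  If two tori are orthogonal and \<open>M\<close>, with inverse \<open>N\<close>, is the transition matrix between their bases,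
  then all products \<open>M\<^sub>i\<^sub>j N\<^sub>j\<^sub>i\<close> equal \<open>1/3\<close>. Hence the quotients \<open>M\<^sub>1\<^sub>j / M\<^sub>2\<^sub>j\<close> and their inverses both
  sum to zero, so that their cubes agree and the ratio of two of them is a primitive cube root of
  unity. So two orthogonal tori already force such a root. Conversely, a primitive cube root of unity
  diagonalizes the standard generalized Pauli matrices, whose tori form a decomposition.
\<close>

section \<open>Tori of traceless diagonal matrices\<close>

lemma smul_nth [simp]: "smul c A $ i $ j = c * A $ i $ j"
  by (simp add: smul_def)

lemma matrix_mult_nth: "(A ** B) $ i $ j = (\<Sum>k\<in>UNIV. A $ i $ k * B $ k $ j)"
  by (simp add: matrix_matrix_mult_def)

lemma matrix_eqI: "(\<And>i j. A $ i $ j = B $ i $ j) \<Longrightarrow> A = B"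
  by (simp add: vec_eq_iff)

lemma smul_mult_left: "smul c A ** B = smul c (A ** B)"
  by (rule matrix_eqI) (simp add: matrix_mult_nth sum_distrib_left mult.assoc)

lemma smul_mult_right: "A ** smul c B = smul c (A ** B)"
  by (rule matrix_eqI) (simp add: matrix_mult_nth sum_distrib_left mult_ac)

lemma matrix_diff_ldistrib: "(A::'a::field^3^3) ** (B - C) = A ** B - A ** C"
  by (rule matrix_eqI) (simp add: matrix_mult_nth right_diff_distrib sum_subtractf)

lemma matrix_diff_rdistrib: "((B::'a::field^3^3) - C) ** A = B ** A - C ** A"
  by (rule matrix_eqI) (simp add: matrix_mult_nth left_diff_distrib sum_subtractf)

lemma matrix_add_rdistrib: "((B::'a::field^3^3) + C) ** A = B ** A + C ** A"
  by (rule matrix_eqI) (simp add: matrix_mult_nth distrib_right sum.distrib)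

lemma mtrace_add: "mtrace (A + B) = mtrace A + mtrace B"
  by (simp add: mtrace_def sum.distrib)

lemma mtrace_diff: "mtrace (A - B) = mtrace A - mtrace B"
  by (simp add: mtrace_def sum_subtractf)

lemma mtrace_smul: "mtrace (smul c A) = c * mtrace A"
  by (simp add: mtrace_def sum_distrib_left)

lemma mtrace_mult_commute: "mtrace (A ** B) = mtrace (B ** A)"
proof -
  have "mtrace (A ** B) = (\<Sum>k\<in>UNIV. \<Sum>i\<in>UNIV. A $ i $ k * B $ k $ i)"
    unfolding mtrace_def matrix_mult_nth by (rule sum.swap)
  then show ?thesis by (simp add: mtrace_def matrix_mult_nth mult.commute)
qed

lemma sl3_closed [simp]:
  "0 \<in> sl3" "x \<in> sl3 \<Longrightarrow> y \<in> sl3 \<Longrightarrow> x + y \<in> sl3" "x \<in> sl3 \<Longrightarrow> smul c x \<in> sl3"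
  "lie x y \<in> sl3"
  by (simp_all add: sl3_def mtrace_add mtrace_smul lie_def mtrace_diff mtrace_mult_commute[of x y])
    (simp add: mtrace_def)

lemma fspan_least:
  assumes "S \<subseteq> V" "0 \<in> V" "\<And>x y. x \<in> V \<Longrightarrow> y \<in> V \<Longrightarrow> x + y \<in> V" "\<And>c x. x \<in> V \<Longrightarrow> smul c x \<in> V"
  shows "fspan S \<subseteq> V"
proof
  fix x assume "x \<in> fspan S"
  then obtain T c where T: "finite T" "T \<subseteq> S" "x = (\<Sum>t\<in>T. smul (c t) t)"
    by (auto simp: fspan_def)
  have "(\<Sum>t\<in>T. smul (c t) t) \<in> V"
    using T(1,2) by (induction T rule: finite_induct) (use assms in auto)
  with T show "x \<in> V" by simp
qed

lemma smul_in_fspan: "x \<in> S \<Longrightarrow> smul c x \<in> fspan S"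
  unfolding fspan_def by (intro CollectI exI[of _ "{x}"] exI[of _ "\<lambda>_. c"]) auto

lemma numerals_nonzero:
  assumes "CHAR('a::field) > 3"
  shows "(2::'a) \<noteq> 0" "(3::'a) \<noteq> 0"
proof -
  have "of_nat n \<noteq> (0::'a)" if "n \<in> {1,2,3}" for n :: nat
    using that assms by (auto simp: of_nat_eq_0_iff_char_dvd dest!: dvd_imp_le)
  from this[of 2] this[of 3] show "(2::'a) \<noteq> 0" "(3::'a) \<noteq> 0" by auto
qed

section \<open>Coordinates in a basis and the root spaces of its torus\<close>

locale frame =
  fixes g g' :: "'a::field^3^3"
  assumes right_inv: "g ** g' = mat 1" and left_inv: "g' ** g = mat 1"
begin

text \<open>The columns of \<open>g\<close> are the basis vectors, so this is the matrix of
  \<open>x\<close> in that basis.\<close>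

definition coords :: "'a^3^3 \<Rightarrow> 'a^3^3" where
  "coords x = g' ** x ** g"

definition torus :: "('a^3^3) set" where
  "torus = {x \<in> sl3. \<forall>i j. i \<noteq> j \<longrightarrow> coords x $ i $ j = 0}"

text \<open>The order of the difference comes from \<open>lie x h = x ** h - h ** x\<close>, which
  scales a matrix unit at \<open>(i, j)\<close> by diagonal entry \<open>j\<close> minus diagonal
  entry \<open>i\<close> of \<open>h\<close>. Vanishing off the torus is the normalisation demanded
  by \<open>lin_fun\<close>.\<close>

definition root :: "3 \<Rightarrow> 3 \<Rightarrow> 'a^3^3 \<Rightarrow> 'a" where
  "root i j h = (if h \<in> torus then coords h $ j $ j - coords h $ i $ i else 0)"

lemma cancel_inv: "x ** g ** g' = x" "x ** g' ** g = x"
  by (simp_all add: matrix_mul_assoc[symmetric] right_inv left_inv)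

lemma coords_of [simp]: "coords (g ** y ** g') = y"
  by (simp add: coords_def matrix_mul_assoc cancel_inv left_inv)

lemma of_coords: "g ** coords x ** g' = x"
  by (simp add: coords_def matrix_mul_assoc cancel_inv right_inv)

lemma coords_inj: "coords x = coords y \<Longrightarrow> x = y"
  by (metis of_coords)

lemma coords_eqI: "(\<And>i j. coords x $ i $ j = coords y $ i $ j) \<Longrightarrow> x = y"
  by (rule coords_inj, rule matrix_eqI)

lemma coords_eq_iff: "x = y \<longleftrightarrow> (\<forall>i j. coords x $ i $ j = coords y $ i $ j)"
  using coords_eqI by blast

lemma coords_mult: "coords (x ** y) = coords x ** coords y"
  by (simp add: coords_def matrix_mul_assoc cancel_inv)

lemma coords_add: "coords (x + y) = coords x + coords y"
  by (simp add: coords_def matrix_add_ldistrib matrix_add_rdistrib)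

lemma coords_diff: "coords (x - y) = coords x - coords y"
  by (simp add: coords_def matrix_diff_ldistrib matrix_diff_rdistrib)

lemma coords_smul: "coords (smul c x) = smul c (coords x)"
  by (simp add: coords_def smul_mult_left smul_mult_right)

lemma coords_zero [simp]: "coords 0 = 0"
  using coords_diff[of 0 0] by simp

lemma coords_sum: "coords (\<Sum>i\<in>I. f i) = (\<Sum>i\<in>I. coords (f i))"
  by (induction I rule: infinite_finite_induct) (auto simp: coords_add)

lemma coords_lie: "coords (lie x y) = lie (coords x) (coords y)"
  by (simp add: lie_def coords_diff coords_mult)

lemma mtrace_coords: "mtrace (coords x) = mtrace x"
proof -
  have "mtrace (coords x) = mtrace (g ** (g' ** x))"
    unfolding coords_def by (rule mtrace_mult_commute)
  then show ?thesis by (simp add: matrix_mul_assoc right_inv)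
qed

lemma coords_sl3_iff: "x \<in> sl3 \<longleftrightarrow> (\<Sum>i\<in>UNIV. coords x $ i $ i) = 0"
  using mtrace_coords[of x] by (simp add: sl3_def mtrace_def)

lemma torus_coords: "h \<in> torus \<Longrightarrow> coords h $ i $ j = (if i = j then coords h $ i $ i else 0)"
  by (auto simp: torus_def)

lemma coords_lie_torus:
  assumes "h \<in> torus"
  shows "coords (lie x h) $ i $ j = root i j h * coords x $ i $ j"
proof -
  have "(coords x ** coords h) $ i $ j = coords x $ i $ j * coords h $ j $ j"
    unfolding matrix_mult_nth by (subst torus_coords[OF assms]) (simp add: if_distrib sum.delta cong: if_cong)
  moreover have "(coords h ** coords x) $ i $ j = coords h $ i $ i * coords x $ i $ j"
    unfolding matrix_mult_nth by (subst torus_coords[OF assms]) (simp add: if_distrib if_distribR sum.delta cong: if_cong)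
  ultimately show ?thesis
    using assms by (simp add: coords_lie lie_def[of "coords x"] root_def algebra_simps)
qed

lemma torus_subspace: "subspace_of sl3 torus"
  by (auto simp: subspace_of_def torus_def coords_add coords_smul)

lemma torus_abelian: "lie_abelian torus"
  unfolding lie_abelian_def
proof (intro ballI)
  fix x y assume "x \<in> torus" "y \<in> torus"
  then show "lie x y = 0"
    by (intro coords_eqI) (metis coords_lie_torus torus_coords root_def coords_zero diff_self mult_eq_0_iff zero_index)
qed

lemma lin_fun_root: "lin_fun torus (root i j)"
  using torus_subspace
  by (auto simp: lin_fun_def root_def coords_add coords_smul subspace_of_def algebra_simps)

lemma root_diag [simp]: "root i i = (\<lambda>_. 0)"
  by (auto simp: root_def)

lemma root_swap: "root j i = (\<lambda>h. - root i j h)"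
  by (auto simp: root_def)

text \<open>Bracketing with the torus scales each coordinate separately, coordinate
  \<open>(i, j)\<close> by \<open>root i j\<close>. Agreement with \<open>\<alpha>\<close> on the
  torus is equality of functions because both vanish elsewhere. Several pairs may share a
  root.\<close>

lemma root_space_iff:
  assumes "lin_fun torus \<alpha>"
  shows "x \<in> root_space torus \<alpha> \<longleftrightarrow> x \<in> sl3 \<and> (\<forall>i j. coords x $ i $ j \<noteq> 0 \<longrightarrow> \<alpha> = root i j)"
proof -
  have "(\<forall>h\<in>torus. lie x h = smul (\<alpha> h) x) \<longleftrightarrow>
        (\<forall>h\<in>torus. \<forall>i j. root i j h * coords x $ i $ j = \<alpha> h * coords x $ i $ j)"
    by (simp add: coords_eq_iff coords_lie_torus coords_smul)
  also have "\<dots> \<longleftrightarrow> (\<forall>i j. coords x $ i $ j \<noteq> 0 \<longrightarrow> (\<forall>h\<in>torus. root i j h = \<alpha> h))"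
    unfolding mult_cancel_right by blast
  also have "\<dots> \<longleftrightarrow> (\<forall>i j. coords x $ i $ j \<noteq> 0 \<longrightarrow> \<alpha> = root i j)"
  proof -
    have "(\<forall>h\<in>torus. root i j h = \<alpha> h) \<longleftrightarrow> \<alpha> = root i j" for i j
    proof
      assume eq: "\<forall>h\<in>torus. root i j h = \<alpha> h"
      show "\<alpha> = root i j"
      proof
        fix h show "\<alpha> h = root i j h"
          using eq assms lin_fun_root[of i j] by (cases "h \<in> torus") (auto simp: lin_fun_def)
      qed
    qed simp
    then show ?thesis by (simp only:)
  qed
  finally show ?thesis unfolding root_space_def by blast
qed

lemma root_space_sum_decomp:
  "is_dsum sl3 {\<alpha>. lin_fun torus \<alpha>} (root_space torus)"
  unfolding is_dsum_def
proof (intro conjI ballI)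
  fix \<alpha> assume "\<alpha> \<in> {\<alpha>. lin_fun torus \<alpha>}"
  then have l: "lin_fun torus \<alpha>" by simp
  show "subspace_of sl3 (root_space torus \<alpha>)"
    unfolding subspace_of_def
  proof (intro conjI ballI allI)
    show "root_space torus \<alpha> \<subseteq> sl3" by (auto simp: root_space_def)
    show "0 \<in> root_space torus \<alpha>" by (auto simp: root_space_iff[OF l])
  next
    fix x y assume "x \<in> root_space torus \<alpha>" "y \<in> root_space torus \<alpha>"
    then show "x + y \<in> root_space torus \<alpha>"
      unfolding root_space_iff[OF l] by (auto simp: coords_add) (metis add_cancel_left_right)
  next
    fix c x assume "x \<in> root_space torus \<alpha>"
    then show "smul c x \<in> root_space torus \<alpha>"
      unfolding root_space_iff[OF l] by (auto simp: coords_smul)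
  qed
next
  fix x :: "'a^3^3" assume x: "x \<in> sl3"
  \<comment> \<open>Component \<open>\<alpha>\<close> collects the entries whose root is
    \<open>\<alpha>\<close>; the whole diagonal goes to the zero functional.\<close>
  define F where "F = (\<lambda>\<alpha>. g ** (\<chi> i j. if \<alpha> = root i j then coords x $ i $ j else 0) ** g')"
  have F: "coords (F \<alpha>) $ i $ j = (if \<alpha> = root i j then coords x $ i $ j else 0)" for \<alpha> i j
    by (simp add: F_def)
  define R where "R = (\<lambda>(i,j). root i j) ` (UNIV :: (3 \<times> 3) set)"
  have finR: "finite R" by (simp add: R_def)
  have inR: "root i j \<in> R" for i j by (force simp: R_def)
  have F0: "F \<alpha> = 0" if "\<alpha> \<notin> R" for \<alpha>
    by (rule coords_eqI) (use that inR in \<open>auto simp: F\<close>)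
  have finF: "finite {\<alpha>. F \<alpha> \<noteq> 0}"
    by (rule finite_subset[OF _ finR]) (use F0 in auto)
  show "\<exists>!f. (\<forall>\<alpha>. f \<alpha> \<in> (if \<alpha> \<in> {\<alpha>. lin_fun torus \<alpha>} then root_space torus \<alpha> else {0}))
           \<and> finite {\<alpha>. f \<alpha> \<noteq> 0} \<and> x = (\<Sum>\<alpha>\<in>{\<alpha>. f \<alpha> \<noteq> 0}. f \<alpha>)"
  proof (rule ex1I[of _ F], intro conjI allI)
    fix \<alpha>
    show "F \<alpha> \<in> (if \<alpha> \<in> {\<alpha>. lin_fun torus \<alpha>} then root_space torus \<alpha> else {0})"
    proof (cases "lin_fun torus \<alpha>")
      case True
      \<comment> \<open>The diagonal of \<open>F \<alpha>\<close> is that of \<open>x\<close> for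
        the zero functional and zero otherwise, so the trace vanishes either way.\<close>
      have "F \<alpha> \<in> sl3"
        using x by (cases "\<alpha> = (\<lambda>_. 0)") (simp_all add: coords_sl3_iff F)
      then show ?thesis using True by (auto simp: root_space_iff F)
    next
      case False
      then have "\<alpha> \<notin> R" using lin_fun_root by (auto simp: R_def)
      then show ?thesis using F0 False by simp
    qed
  next
    show "finite {\<alpha>. F \<alpha> \<noteq> 0}" by fact
    have "(\<Sum>\<alpha>\<in>{\<alpha>. F \<alpha> \<noteq> 0}. F \<alpha>) = (\<Sum>\<alpha>\<in>R. F \<alpha>)"
      by (rule sum.mono_neutral_left) (use F0 finR in auto)
    also have "\<dots> = x"
      by (rule coords_eqI) (simp add: coords_sum F finR inR)
    finally show "x = (\<Sum>\<alpha>\<in>{\<alpha>. F \<alpha> \<noteq> 0}. F \<alpha>)" by simp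
  next
    fix f
    assume f: "(\<forall>\<alpha>. f \<alpha> \<in> (if \<alpha> \<in> {\<alpha>. lin_fun torus \<alpha>} then root_space torus \<alpha> else {0}))
           \<and> finite {\<alpha>. f \<alpha> \<noteq> 0} \<and> x = (\<Sum>\<alpha>\<in>{\<alpha>. f \<alpha> \<noteq> 0}. f \<alpha>)"
    have off: "coords (f \<alpha>) $ i $ j = 0" if "\<alpha> \<noteq> root i j" for \<alpha> i j
    proof (cases "lin_fun torus \<alpha>")
      case True
      then show ?thesis using f that by (metis mem_Collect_eq root_space_iff)
    next
      case False
      then have "f \<alpha> = 0" using f by (metis mem_Collect_eq singletonD)
      then show ?thesis by simp
    qed
    \<comment> \<open>Uniqueness: entry \<open>(i, j)\<close> of the sum receives a contribution
      from the component at \<open>root i j\<close> only.\<close>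
    have on: "coords x $ i $ j = coords (f (root i j)) $ i $ j" for i j
    proof -
      have "coords x $ i $ j = (\<Sum>\<alpha>\<in>{\<alpha>. f \<alpha> \<noteq> 0}. coords (f \<alpha>) $ i $ j)"
        using f coords_sum[of f "{\<alpha>. f \<alpha> \<noteq> 0}"] by (simp add: sum_component)
      also have "\<dots> = (\<Sum>\<alpha>\<in>{\<alpha>. f \<alpha> \<noteq> 0}. if \<alpha> = root i j then coords (f (root i j)) $ i $ j else 0)"
        by (rule sum.cong) (auto simp: off)
      also have "\<dots> = coords (f (root i j)) $ i $ j"
        using f by (auto simp: )
      finally show ?thesis .
    qed
    show "f = F"
      by (rule ext, rule coords_eqI) (auto simp: F off on)
  qed
qed

section \<open>Coweights and the axioms of a classical Cartan subalgebra\<close>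

lemma ex_coweight:
  "\<exists>h\<in>torus. \<forall>i j. root i j h = 3 * ((if j = m then 1 else 0) - (if i = m then 1 else 0))"
proof -
  \<comment> \<open>In coordinates this is three times the matrix unit at \<open>(m, m)\<close>
    minus the identity, of trace \<open>3 - 3 = 0\<close>; the factor 3 avoids a division.\<close>
  define h where "h = g ** (\<chi> i j. if i = j then (if i = m then 3 else 0) - 1 else 0) ** g'"
  have c: "coords h $ i $ j = (if i = j then (if i = m then 3 else 0) - 1 else 0)" for i j
    by (simp add: h_def)
  have "h \<in> torus"
    by (auto simp: torus_def c coords_sl3_iff sum_subtractf)
  moreover from this have "root i j h = 3 * ((if j = m then 1 else 0) - (if i = m then 1 else 0))" for i j
    by (simp add: root_def c)
  ultimately show ?thesis by blast
qed

lemma is_root_cases: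
  assumes "is_root torus \<alpha>"
  obtains i j where "\<alpha> = root i j"
proof -
  have l: "lin_fun torus \<alpha>" using assms by (simp add: is_root_def)
  have "0 \<in> root_space torus \<alpha>" by (simp add: root_space_iff[OF l])
  then obtain x where "x \<in> root_space torus \<alpha>" "x \<noteq> 0"
    using assms unfolding is_root_def by blast
  moreover from \<open>x \<noteq> 0\<close> obtain i j where "coords x $ i $ j \<noteq> 0"
    by (metis coords_eqI coords_zero zero_index)
  ultimately show ?thesis using that l by (auto simp: root_space_iff)
qed

lemma cartan_torus:
  assumes "(3::'a) \<noteq> 0"
  shows "cartan torus"
  unfolding cartan_def
proof (intro conjI)
  have zero: "lie x y = 0" if "x \<in> torus" "y \<in> torus" for x y
    using torus_abelian that by (simp add: lie_abelian_def)
  have "0 \<in> torus" using torus_subspace by (simp add: subspace_of_def)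
  then have "{lie x y |x y. x \<in> torus \<and> y \<in> torus} = {0}" using zero by force
  moreover have "fspan {0 :: 'a^3^3} \<subseteq> {0}"
    by (rule fspan_least) (auto simp: smul_def vec_eq_iff)
  moreover have "smul 0 0 \<in> fspan {0 :: 'a^3^3}" by (rule smul_in_fspan) simp
  ultimately have "lcs torus 1 = {0}" by auto
  then show "lie_nilpotent torus" unfolding lie_nilpotent_def by blast
  show "lie_subalg torus"
    using torus_subspace zero \<open>0 \<in> torus\<close> by (simp add: lie_subalg_def)
  show "normalizer torus = torus"
  proof
    show "torus \<subseteq> normalizer torus"
      using zero \<open>0 \<in> torus\<close> by (auto simp: normalizer_def torus_def)
    show "normalizer torus \<subseteq> torus"
    proof
      fix x assume x: "x \<in> normalizer torus"
      have "coords x $ i $ j = 0" if "i \<noteq> j" for i j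
      proof -
        \<comment> \<open>Bracketing with the coweight at \<open>j\<close> multiplies entry
          \<open>(i, j)\<close> by 3, so this entry must vanish when the bracket is
          diagonal.\<close>
        from ex_coweight[of j] obtain h where "h \<in> torus"
          "\<And>k l. root k l h = 3 * ((if l = j then 1 else 0) - (if k = j then 1 else 0))" by blast
        with that have h: "h \<in> torus" "root i j h = 3" by simp_all
        then have "lie x h \<in> torus" using x by (simp add: normalizer_def)
        then have "coords (lie x h) $ i $ j = 0" using that by (simp add: torus_def)
        then show ?thesis using h assms by (simp add: coords_lie_torus)
      qed
      then show "x \<in> torus" using x by (simp add: torus_def normalizer_def)
    qed
  qed
qed

text \<open>Equal roots agree on the coweights at \<open>i\<close> and \<open>j\<close>. There
  \<open>root i j\<close> takes the values -3 and 3, which identify both indices because 0, 1 and -1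
  are distinct.\<close>

lemma root_inj:
  assumes "(2::'a) \<noteq> 0" "(3::'a) \<noteq> 0" and "root i j = root k l" "i \<noteq> j"
  shows "i = k \<and> j = l"
proof -
  have eq: "(if j = m then 1 else 0) - (if i = m then 1 else 0)
          = (if l = m then 1 else 0) - (if k = m then 1 else (0::'a))" for m
    using ex_coweight[of m] assms(2,3) by (metis mult_left_cancel)
  have "(1::'a) \<noteq> -1" using assms(1) by (metis one_add_one add.right_inverse)
  then show ?thesis
    using eq[of i] eq[of j] \<open>i \<noteq> j\<close> by (auto split: if_splits)
qed

lemma root_space_eq:
  assumes "(2::'a) \<noteq> 0" "(3::'a) \<noteq> 0" "i \<noteq> j"
  shows "root_space torus (root i j) =
    range (\<lambda>c. g ** (\<chi> k l. if k = i \<and> l = j then c else 0) ** g')"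
proof (intro equalityI subsetI)
  fix x assume "x \<in> root_space torus (root i j)"
  then have "coords x $ k $ l = 0" if "\<not> (k = i \<and> l = j)" for k l
    using root_inj[OF assms(1,2) _ assms(3)] that by (auto simp: root_space_iff[OF lin_fun_root])
  then have "x = g ** (\<chi> k l. if k = i \<and> l = j then coords x $ i $ j else 0) ** g'"
    by (intro coords_eqI) auto
  then show "x \<in> range (\<lambda>c. g ** (\<chi> k l. if k = i \<and> l = j then c else 0) ** g')"
    by blast
next
  fix x assume "x \<in> range (\<lambda>c. g ** (\<chi> k l. if k = i \<and> l = j then c else 0) ** g')"
  then obtain c where "x = g ** (\<chi> k l. if k = i \<and> l = j then c else 0) ** g'" by blast
  then have c: "coords x $ k $ l = (if k = i \<and> l = j then c else 0)" for k l by simp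
  have "(\<Sum>k\<in>UNIV. coords x $ k $ k) = 0"
    by (rule sum.neutral) (use assms(3) in \<open>auto simp: c\<close>)
  then show "x \<in> root_space torus (root i j)"
    by (simp add: root_space_iff[OF lin_fun_root] coords_sl3_iff c)
qed

lemma one_dim_coroot:
  assumes "(2::'a) \<noteq> 0" "(3::'a) \<noteq> 0" "i \<noteq> j"
  shows "one_dim (fspan {lie x y |x y. x \<in> root_space torus (root i j) \<and> y \<in> root_space torus (root j i)})"
    (is "one_dim (fspan ?B)")
proof -
  define E where "E = (\<lambda>i j. g ** (\<chi> k l. if k = i \<and> l = j then 1 else 0) ** g')"
  have cE: "coords (E i j) $ k $ l = (if k = i \<and> l = j then 1 else 0)" for i j k l
    by (simp add: E_def)
  have "g ** (\<chi> k l. if k = i \<and> l = j then c else 0) ** g' = smul c (E i j)" for i j c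
    by (rule coords_eqI) (simp add: coords_smul cE)
  then have rs: "root_space torus (root i j) = range (\<lambda>c. smul c (E i j))" if "i \<noteq> j" for i j
    using root_space_eq[OF assms(1,2) that] by simp
  define v where "v = lie (E i j) (E j i)"
  have lie_smul: "lie (smul c x) (smul d y) = smul (c * d) (lie x y)" for c d and x y :: "'a^3^3"
    by (rule matrix_eqI) (simp add: lie_def smul_mult_left smul_mult_right algebra_simps)
  have rs': "x \<in> root_space torus (root i j) \<longleftrightarrow> (\<exists>c. x = smul c (E i j))" if "i \<noteq> j" for i j x
    unfolding rs[OF that] by auto
  \<comment> \<open>Both root spaces are lines, so the brackets already form the line through
    \<open>v\<close> and the span adds nothing.\<close>
  have B: "z \<in> ?B \<longleftrightarrow> (\<exists>c. z = smul c v)" for z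
  proof
    assume "z \<in> ?B"
    then obtain x y where xy: "z = lie x y" "x \<in> root_space torus (root i j)" "y \<in> root_space torus (root j i)"
      by auto
    obtain c where c: "x = smul c (E i j)" using xy(2) rs'[OF assms(3)] by auto
    obtain d where d: "y = smul d (E j i)" using xy(3) rs'[OF assms(3)[symmetric]] by auto
    have "z = smul (c * d) v" by (simp add: lie_smul v_def xy(1) c d)
    then show "\<exists>c. z = smul c v" by (rule exI)
  next
    assume "\<exists>c. z = smul c v"
    then obtain c where "z = smul c v" by (elim exE)
    then have "z = lie (smul c (E i j)) (smul 1 (E j i))" by (simp add: lie_smul v_def)
    moreover have "smul c (E i j) \<in> root_space torus (root i j)" using rs'[OF assms(3)] by auto
    moreover have "smul 1 (E j i) \<in> root_space torus (root j i)" using rs'[OF assms(3)[symmetric]] by auto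
    ultimately show "z \<in> ?B" by auto
  qed
  have "fspan ?B = range (\<lambda>c. smul c v)"
  proof
    show "fspan ?B \<subseteq> range (\<lambda>c. smul c v)"
    proof (rule fspan_least)
      have "0 = smul 0 v" by (rule matrix_eqI) simp
      then show "0 \<in> range (\<lambda>c. smul c v)" by blast
    next
      fix x y assume "x \<in> range (\<lambda>c. smul c v)" "y \<in> range (\<lambda>c. smul c v)"
      then obtain c d where "x = smul c v" "y = smul d v" by blast
      then have "x + y = smul (c + d) v" by (intro matrix_eqI) (simp add: algebra_simps)
      then show "x + y \<in> range (\<lambda>c. smul c v)" by blast
    next
      fix c x assume "x \<in> range (\<lambda>c. smul c v)"
      then obtain d where "x = smul d v" by blast
      then have "smul c x = smul (c * d) v" by (intro matrix_eqI) (simp add: algebra_simps)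
      then show "smul c x \<in> range (\<lambda>c. smul c v)" by blast
    qed (use B in auto)
    have "smul c v \<in> fspan ?B" for c
    proof (rule smul_in_fspan)
      have "v = smul 1 v" by (rule matrix_eqI) simp
      then show "v \<in> ?B" unfolding B by (rule exI)
    qed
    then show "range (\<lambda>c. smul c v) \<subseteq> fspan ?B" by blast
  qed
  moreover have "v \<noteq> 0"
  proof
    \<comment> \<open>In coordinates \<open>v\<close> is the difference of the matrix units at
      \<open>(i, i)\<close> and \<open>(j, j)\<close>.\<close>
    have "coords v $ i $ i = (\<Sum>k\<in>UNIV. if k = j then 1 else 0)"
      using assms(3)
      by (simp add: v_def lie_def coords_diff coords_mult matrix_mult_nth cE if_distrib cong: if_cong)
    then have "coords v $ i $ i = 1" by simp
    moreover assume "v = 0"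
    ultimately show False by simp
  qed
  ultimately show ?thesis unfolding one_dim_def by blast
qed

text \<open>The coweight at \<open>j\<close> has value 3 on \<open>root i j\<close> and only the
  values 0, 3 and -3 on roots. After division by 3, a full string would put \<open>t\<close>,
  \<open>t + 1\<close>, \<open>t + 2\<close> and \<open>t + 3\<close> into
  \<open>{0, 1, -1}\<close>, which is impossible when 2 and 3 are nonzero.\<close>

lemma no_long_root_string:
  assumes "(2::'a) \<noteq> 0" "(3::'a) \<noteq> 0" "i \<noteq> j" "is_root torus \<alpha>"
  shows "\<exists>k\<in>{1,2,3::nat}. \<not> is_root torus (\<lambda>h. \<alpha> h + of_nat k * root i j h)"
proof (rule ccontr)
  assume "\<not> ?thesis"
  then have k: "is_root torus (\<lambda>h. \<alpha> h + of_nat k * root i j h)" if "k \<in> {0,1,2,3}" for k :: nat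
    using that assms(4) by auto
  from ex_coweight[of j] obtain h where
    h: "\<And>k l. root k l h = 3 * ((if l = j then 1 else 0) - (if k = j then 1 else 0))" by blast
  have val: "\<gamma> h \<in> {0, 3, -3}" if "is_root torus \<gamma>" for \<gamma>
    using that by (rule is_root_cases) (auto simp: h)
  define t where "t = \<alpha> h / 3"
  have t: "t + of_nat k \<in> {0, 1, -1}" if "k \<in> {0,1,2,3}" for k :: nat
    using val[OF k[OF that]] assms(2,3)
    by (auto simp: t_def h field_simps)
  have "t \<in> {0,1,-1}" "t + 1 \<in> {0,1,-1}" "t + 2 \<in> {0,1,-1}" "t + 3 \<in> {0,1,-1}"
    using t[of 0] t[of 1] t[of 2] t[of 3] by auto
  then show False using assms(1,2) by auto
qed

lemma classical_cartan_torus: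
  assumes "CHAR('a) > 3"
  shows "classical_cartan torus"
  unfolding classical_cartan_def
proof (intro conjI allI impI)
  note nz = numerals_nonzero[OF assms]
  have pos: "\<exists>i j. i \<noteq> j \<and> \<alpha> = root i j" if "is_root torus \<alpha>" "\<alpha> \<noteq> (\<lambda>_. 0)" for \<alpha>
    using that by (metis is_root_cases root_diag)
  show "cartan torus" using nz by (rule_tac cartan_torus)
  show "lie_abelian torus" by (rule torus_abelian)
  show "is_dsum sl3 {\<alpha>. lin_fun torus \<alpha>} (root_space torus)" by (rule root_space_sum_decomp)
  show "one_dim (fspan {lie x y |x y. x \<in> root_space torus \<alpha> \<and> y \<in> root_space torus (\<lambda>h. - \<alpha> h)})"
    if a: "is_root torus \<alpha> \<and> \<alpha> \<noteq> (\<lambda>_. 0)" for \<alpha>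
  proof -
    obtain i j where ij: "i \<noteq> j" "\<alpha> = root i j" using pos a by blast
    have "root j i = (\<lambda>h. - \<alpha> h)" unfolding ij(2) by (rule root_swap)
    then show ?thesis using one_dim_coroot[OF nz ij(1)] by (simp only: ij(2)[symmetric])
  qed
  show "\<not> (\<forall>k\<in>{1..CHAR('a) - 1}. is_root torus (\<lambda>h. \<alpha> h + of_nat k * \<beta> h))"
    if ab: "is_root torus \<alpha> \<and> is_root torus \<beta> \<and> \<beta> \<noteq> (\<lambda>_. 0)" for \<alpha> \<beta>
  proof -
    obtain i j where "i \<noteq> j" "\<beta> = root i j" using pos ab by blast
    then obtain k :: nat where "k \<in> {1,2,3}" "\<not> is_root torus (\<lambda>h. \<alpha> h + of_nat k * \<beta> h)"
      using no_long_root_string[OF nz, of i j \<alpha>] ab by blast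
    \<comment> \<open>Characteristic greater than 3 makes \<open>{1..CHAR('a) - 1}\<close> contain
      1, 2 and 3.\<close>
    moreover from \<open>k \<in> {1,2,3}\<close> have "k \<in> {1..CHAR('a) - 1}" using assms by auto
    ultimately show ?thesis by blast
  qed
qed

end

section \<open>Classical Cartan subalgebras are tori\<close>

lemma smul_vec: "smul c A *v v = c *s (A *v v)"
  by (simp add: vec_eq_iff matrix_vector_mult_def sum_distrib_left mult.assoc)

lemma sum_matrix_vec: "(\<Sum>i\<in>I. f i) *v (v::'a::field^3) = (\<Sum>i\<in>I. f i *v v)"
  by (induction I rule: infinite_finite_induct) (auto simp: matrix_vector_mult_add_rdistrib)

lemma matrix_power2_nth: "(A ** A) $ i $ j = A$i$1 * A$1$j + A$i$2 * A$2$j + A$i$3 * A$3$j"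
  for A :: "'a::field^3^3"
  by (simp add: matrix_mult_nth sum_3)

lemma mtrace_3: "mtrace A = A$1$1 + A$2$2 + A$3$3"
  by (simp add: mtrace_def sum_3)

text \<open>The second elementary symmetric function of the eigenvalues, a coefficient of the
  characteristic polynomial.\<close>

definition principal_minor_sum :: "'a::field^3^3 \<Rightarrow> 'a" where
  "principal_minor_sum A = A$1$1*A$2$2 - A$1$2*A$2$1 + A$1$1*A$3$3 - A$1$3*A$3$1 + A$2$2*A$3$3 - A$2$3*A$3$2"

text \<open>Newton's identity: twice this coefficient is the squared trace minus the trace of the
  square.\<close>

lemma principal_minor_sum_eq_0:
  fixes A :: "'a::field^3^3"
  assumes "(2::'a) \<noteq> 0" "mtrace A = 0" "mtrace (A ** A) = 0"
  shows "principal_minor_sum A = 0"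
proof -
  have "2 * principal_minor_sum A = mtrace A ^ 2 - mtrace (A ** A)"
    by (simp add: principal_minor_sum_def mtrace_3 matrix_power2_nth power2_eq_square algebra_simps)
  then have "2 * principal_minor_sum A = 0" by (simp add: assms)
  then show ?thesis using assms(1) by (metis mult_eq_0_iff)
qed

text \<open>By Cayley-Hamilton the cube is \<open>det A\<close> times the identity, since the other
  two coefficients vanish. Its trace is then \<open>3 * det A\<close>, so the determinant vanishes
  as well.\<close>

lemma cube_eq_zero:
  fixes A :: "'a::field^3^3"
  assumes "(2::'a) \<noteq> 0" "(3::'a) \<noteq> 0"
    and "mtrace A = 0" "mtrace (A ** A) = 0" "mtrace (A ** A ** A) = 0"
  shows "A ** A ** A = 0"
proof -
  let ?e2 = "principal_minor_sum A"
  have e2: "?e2 = 0" by (rule principal_minor_sum_eq_0[OF assms(1,3,4)])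
  have CH: "(A ** A ** A) $ i $ j = mtrace A * (A ** A) $ i $ j - ?e2 * A $ i $ j + (if i = j then det A else 0)" for i j
  proof -
    have "\<forall>i j. (A ** A ** A) $ i $ j = mtrace A * (A ** A) $ i $ j - ?e2 * A $ i $ j + (if i = j then det A else 0)"
      unfolding forall_3
      by (simp add: matrix_mult_nth sum_3 mtrace_3 det_3 principal_minor_sum_def algebra_simps)
    then show ?thesis by blast
  qed
  have "mtrace (A ** A ** A) = 3 * det A"
    using CH[of 1 1] CH[of 2 2] CH[of 3 3] assms(3) e2 by (simp add: mtrace_3[of "A ** A ** A"])
  then have "det A = 0" using assms by simp
  then show ?thesis using CH e2 assms(3) by (intro matrix_eqI) simp
qed

text \<open>The adjugate of \<open>A\<close> is \<open>A\<^sup>2 - tr A \<cdot> A + e\<^sub>2(A)\<close>, which vanishes here.\<close>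
lemma square_zero_minors:
  fixes A :: "'a::field^3^3"
  assumes "(2::'a) \<noteq> 0" "mtrace A = 0" "A ** A = 0"
  shows "A $ i $ j * A $ p $ q = A $ i $ q * A $ p $ j"
proof -
  let ?e2 = "principal_minor_sum A"
  have "mtrace (A ** A) = 0" by (simp add: assms(3)) (simp add: mtrace_def)
  then have e2: "?e2 = 0" by (rule principal_minor_sum_eq_0[OF assms(1,2)])
  have sq: "A$i$1 * A$1$j + A$i$2 * A$2$j + A$i$3 * A$3$j = 0" for i j
    using assms(3) matrix_power2_nth[of A i j] by simp
  have tr: "A$1$1 + A$2$2 + A$3$3 = 0" using assms(2) by (simp add: mtrace_3)
  note sqs = sq[of 1 1] sq[of 1 2] sq[of 1 3] sq[of 2 1] sq[of 2 2] sq[of 2 3] sq[of 3 1] sq[of 3 2] sq[of 3 3]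
  have
    "A$1$1*A$2$2 = A$1$2*A$2$1" "A$1$1*A$3$3 = A$1$3*A$3$1" "A$2$2*A$3$3 = A$2$3*A$3$2"
    "A$1$1*A$2$3 = A$1$3*A$2$1" "A$1$2*A$2$3 = A$1$3*A$2$2" "A$1$1*A$3$2 = A$1$2*A$3$1"
    "A$1$2*A$3$3 = A$1$3*A$3$2" "A$2$1*A$3$2 = A$2$2*A$3$1" "A$2$1*A$3$3 = A$2$3*A$3$1"
    using sqs tr e2[unfolded principal_minor_sum_def] by algebra+
  then show ?thesis
    using exhaust_3[of i] exhaust_3[of j] exhaust_3[of p] exhaust_3[of q]
    by (elim disjE; hypsubst; simp add: mult.commute)
qed

text \<open>The zero vector is included, so that a root vector may annihilate a member and still map
  into the set.\<close>

definition eigvecs :: "('a::field^3^3) set \<Rightarrow> ('a^3) set" where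
  "eigvecs H = {v. \<forall>h\<in>H. \<exists>c. h *v v = c *s v}"

text \<open>Moving \<open>h\<close> past \<open>x\<close> costs \<open>\<alpha> h\<close>, so the
  eigenvalue \<open>c\<close> of \<open>h\<close> at \<open>v\<close> becomes
  \<open>c - \<alpha> h\<close> at \<open>x *v v\<close>.\<close>

lemma root_vector_eigvec:
  assumes "\<And>h. h \<in> H \<Longrightarrow> lie x h = smul (\<alpha> h) x" and v: "v \<in> eigvecs H"
  shows "x *v v \<in> eigvecs H"
  unfolding eigvecs_def
proof (intro CollectI ballI)
  fix h assume h: "h \<in> H"
  then obtain c where c: "h *v v = c *s v" using v by (auto simp: eigvecs_def)
  have "h ** x = x ** h - smul (\<alpha> h) x"
    using assms(1)[OF h] by (simp add: lie_def algebra_simps)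
  then have "h *v (x *v v) = x *v (h *v v) - \<alpha> h *s (x *v v)"
    by (simp add: matrix_vector_mul_assoc matrix_vector_mult_diff_rdistrib smul_vec)
  also have "\<dots> = (c - \<alpha> h) *s (x *v v)"
    by (simp add: c vec.scale vec.scale_left_diff_distrib)
  finally show "\<exists>c. h *v (x *v v) = c *s (x *v v)" by blast
qed

text \<open>The trace form makes \<open>x\<close> nilpotent; then \<open>x\<close> or its square is
  a nonzero weight vector of square zero. Such a matrix has rank one, and \<open>H\<close> preserves
  its image.\<close>

lemma ex_eigvec:
  fixes x :: "'a::field^3^3"
  assumes nz: "(2::'a) \<noteq> 0" "(3::'a) \<noteq> 0"
    and x: "x \<noteq> 0" "mtrace x = 0" "\<And>h. h \<in> H \<Longrightarrow> lie x h = smul (\<alpha> h) x"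
    and h: "h \<in> H" "\<alpha> h \<noteq> 0"
  shows "\<exists>v\<in>eigvecs H. v \<noteq> 0"
proof -
  \<comment> \<open>If \<open>y\<close> commutes with \<open>x\<close>, then
    \<open>y ** lie x h\<close> has trace zero, but it is also \<open>\<alpha> h\<close> times
    \<open>y ** x\<close>, and \<open>\<alpha> h\<close> is nonzero.\<close>
  have "mtrace (y ** x) = 0" if "y ** x = x ** y" for y
  proof -
    have "y ** (x ** h) = x ** (y ** h)"
      by (simp add: matrix_mul_assoc that)
    also have "mtrace \<dots> = mtrace ((y ** h) ** x)"
      by (rule mtrace_mult_commute)
    finally have "mtrace (y ** lie x h) = 0"
      by (simp add: lie_def matrix_diff_ldistrib mtrace_diff matrix_mul_assoc)
    then have "\<alpha> h * mtrace (y ** x) = 0"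
      using x(3)[OF h(1)] by (simp add: smul_mult_right mtrace_smul)
    then show ?thesis using h(2) by simp
  qed
  \<comment> \<open>Taking for \<open>y\<close> the matrix \<open>x\<close> and its square gives
    zero trace for the square and the cube of \<open>x\<close>.\<close>
  from this[of x] this[of "x ** x"] have "x ** x ** x = 0"
    using nz x(2) by (intro cube_eq_zero) (simp_all add: matrix_mul_assoc)
  then have x4: "(x ** x) ** (x ** x) = 0" by (simp add: matrix_mul_assoc)
  \<comment> \<open>Take \<open>x\<close> itself if its square is zero, otherwise
    \<open>x ** x\<close>, whose weight is \<open>2 * \<alpha> h\<close>.\<close>
  obtain y \<beta> where y: "y \<noteq> 0" "y ** y = 0" "mtrace y = 0" "\<And>h. h \<in> H \<Longrightarrow> lie y h = smul (\<beta> h) y"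
  proof (cases "x ** x = 0")
    case True
    with x show ?thesis by (intro that[of x \<alpha>]) auto
  next
    case False
    have "lie (x ** x) h = smul (2 * \<alpha> h) (x ** x)" if "h \<in> H" for h
    proof -
      have "lie (x ** x) h = x ** lie x h + lie x h ** x"
        by (simp add: lie_def matrix_diff_ldistrib matrix_diff_rdistrib matrix_mul_assoc)
      also have "\<dots> = smul (2 * \<alpha> h) (x ** x)"
        unfolding x(3)[OF that] smul_mult_left smul_mult_right
        by (rule matrix_eqI) (simp add: algebra_simps)
      finally show ?thesis .
    qed
    then show ?thesis
      using False x4 \<open>\<And>y. y ** x = x ** y \<Longrightarrow> mtrace (y ** x) = 0\<close>
      by (intro that[of "x ** x" "\<lambda>h. 2 * \<alpha> h"]) auto
  qed
  obtain p q where pq: "y $ p $ q \<noteq> 0" using y(1) by (metis matrix_eqI zero_index)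
  define u where "u = y *v axis q 1"
  have u: "u $ i = y $ i $ q" for i
    by (simp add: u_def matrix_vector_mult_def axis_def if_distrib cong: if_cong)
  \<comment> \<open>The vanishing 2 by 2 minors make every column of \<open>y\<close> a multiple of
    its column \<open>q\<close>, which is \<open>u\<close>.\<close>
  have rank1: "\<exists>c. y *v w = c *s u" for w
  proof -
    have "(y *v w) $ i = (\<Sum>j\<in>UNIV. y $ p $ j * w $ j) / y $ p $ q * u $ i" for i
    proof -
      have "(y *v w) $ i * y $ p $ q = (\<Sum>j\<in>UNIV. y $ i $ j * y $ p $ q * w $ j)"
        by (simp add: matrix_vector_mult_def sum_distrib_right sum_distrib_left mult_ac)
      also have "\<dots> = (\<Sum>j\<in>UNIV. y $ p $ j * w $ j) * u $ i"
        by (subst square_zero_minors[OF nz(1) y(3,2)])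
          (simp add: u sum_distrib_right sum_distrib_left mult_ac)
      finally show ?thesis using pq by (simp add: field_simps)
    qed
    then show ?thesis
      by (intro exI[of _ "(\<Sum>j\<in>UNIV. y $ p $ j * w $ j) / y $ p $ q"]) (simp add: vec_eq_iff)
  qed
  have "u \<in> eigvecs H"
    unfolding eigvecs_def
  proof (intro CollectI ballI)
    fix h assume h: "h \<in> H"
    have "h ** y = y ** h - smul (\<beta> h) y"
      using y(4)[OF h] by (simp add: lie_def algebra_simps)
    \<comment> \<open>Both terms on the right are multiples of \<open>u\<close>, the first because
      it lies in the image of \<open>y\<close>.\<close>
    then have "h *v u = y *v (h *v axis q 1) - \<beta> h *s u"
      unfolding u_def by (simp add: matrix_vector_mul_assoc matrix_vector_mult_diff_rdistrib smul_vec)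
    moreover obtain c where "y *v (h *v axis q 1) = c *s u" using rank1 by blast
    ultimately have "h *v u = (c - \<beta> h) *s u"
      by (simp add: vec.scale_left_diff_distrib)
    then show "\<exists>c. h *v u = c *s u" by blast
  qed
  moreover have "u \<noteq> 0" using u[of p] pq by auto
  ultimately show ?thesis by blast
qed

section \<open>From a common eigenvector to a diagonalizing basis\<close>

lemma is_dsum_decompose:
  assumes "is_dsum L I V" "x \<in> L"
  obtains f where "\<And>i. f i \<noteq> 0 \<Longrightarrow> f i \<in> V i" "x = (\<Sum>i\<in>{i. f i \<noteq> 0}. f i)"
proof -
  have "\<exists>f. (\<forall>i. f i \<in> (if i \<in> I then V i else {0})) \<and> finite {i. f i \<noteq> 0}
          \<and> x = (\<Sum>i\<in>{i. f i \<noteq> 0}. f i)"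
    using assms unfolding is_dsum_def by (blast intro: ex1_implies_ex)
  then obtain f where f: "\<And>i. f i \<in> (if i \<in> I then V i else {0})" "x = (\<Sum>i\<in>{i. f i \<noteq> 0}. f i)"
    by blast
  have "f i \<in> V i" if "f i \<noteq> 0" for i
    using f(1)[of i] that by (simp split: if_splits)
  with f(2) show ?thesis by (rule that[rotated])
qed

text \<open>Any \<open>w\<close> is the image of \<open>v\<close> under some matrix. Up to a scalar
  matrix this is a sum of root vectors, each of which sends \<open>v\<close> to a common
  eigenvector.\<close>

lemma span_eigvecs:
  fixes H :: "('a::field^3^3) set"
  assumes "(3::'a) \<noteq> 0" and dec: "is_dsum sl3 {\<alpha>. lin_fun H \<alpha>} (root_space H)"
    and v: "v \<in> eigvecs H" "v \<noteq> 0"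
  shows "vec.span (eigvecs H) = UNIV"
proof -
  have "w \<in> vec.span (eigvecs H)" for w
  proof -
    obtain q where q: "v $ q \<noteq> 0" using v(2) by (auto simp: vec_eq_iff)
    \<comment> \<open>The only nonzero column is column \<open>q\<close>, scaled so that
      \<open>v\<close> goes to \<open>w\<close>.\<close>
    define X where "X = (\<chi> i j. if j = q then w $ i / v $ q else 0)"
    have Xv: "X *v v = w"
      using q by (simp add: X_def vec_eq_iff matrix_vector_mult_def if_distrib if_distribR cong: if_cong)
    \<comment> \<open>Removing the trace part lands in \<open>sl3\<close> and changes the image of
      \<open>v\<close> only by a multiple of \<open>v\<close>; this divides by 3.\<close>
    define x where "x = X - smul (mtrace X / 3) (mat 1)"
    have "mtrace (mat 1 :: 'a^3^3) = 3" by (simp add: mtrace_def mat_def)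
    then have "x \<in> sl3" using assms(1) by (simp add: x_def sl3_def mtrace_diff mtrace_smul)
    then obtain f where f: "\<And>\<alpha>. f \<alpha> \<noteq> 0 \<Longrightarrow> f \<alpha> \<in> root_space H \<alpha>"
      "x = (\<Sum>\<alpha>\<in>{\<alpha>. f \<alpha> \<noteq> 0}. f \<alpha>)"
      using is_dsum_decompose[OF dec] by blast
    have "f \<alpha> *v v \<in> eigvecs H" if "f \<alpha> \<noteq> 0" for \<alpha>
    proof (rule root_vector_eigvec[OF _ v(1)])
      have "f \<alpha> \<in> root_space H \<alpha>" using that by (rule f(1))
      then show "lie (f \<alpha>) h = smul (\<alpha> h) (f \<alpha>)" if "h \<in> H" for h
        using that by (simp add: root_space_def)
    qed
    then have "x *v v \<in> vec.span (eigvecs H)"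
      unfolding f(2) sum_matrix_vec by (intro vec.span_sum vec.span_base) simp
    moreover have "w = x *v v + (mtrace X / 3) *s v"
      using Xv by (simp add: x_def matrix_vector_mult_diff_rdistrib smul_vec)
    ultimately show ?thesis
      using v(1) by (simp add: vec.span_add vec.span_scale vec.span_base)
  qed
  then show ?thesis by blast
qed

text \<open>A basis extracted from the spanning set of common eigenvectors supplies the columns of
  \<open>g\<close>, and conjugation by it diagonalizes all of \<open>H\<close> at once.\<close>

lemma ex_eigvec_frame:
  fixes H :: "('a::field^3^3) set"
  assumes "vec.span (eigvecs H) = UNIV"
  shows "\<exists>g g'. frame g g' \<and> (\<forall>h\<in>H. \<forall>i j. i \<noteq> j \<longrightarrow> frame.coords g g' h $ i $ j = 0)"
proof -
  obtain B where B: "B \<subseteq> eigvecs H" "vec.independent B" "eigvecs H \<subseteq> vec.span B"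
    "card B = vec.dim (eigvecs H)"
    by (rule vec.basis_exists)
  have spanB: "vec.span B = UNIV"
    using assms B(3) by (metis vec.span_mono vec.span_span top.extremum_uniqueI)
  have "vec.dim (eigvecs H) = CARD(3)"
    by (metis assms vec.dim_span vec_dim_card)
  then have "card B = card (UNIV :: 3 set)" using B(4) by simp
  moreover have "finite B" using B(2) by (rule vec.finiteI_independent)
  ultimately obtain b where b: "bij_betw b (UNIV :: 3 set) B"
    using finite_same_card_bij[OF finite, of B] by metis
  define g where "g = (\<chi> i j. b j $ i)"
  have col: "column j g = b j" for j by (simp add: g_def column_def vec_eq_iff)
  have "columns g = B"
    using b by (auto simp: columns_def col bij_betw_def)
  then obtain g' where "g ** g' = mat 1"
    using matrix_right_invertible_span_columns[of g] spanB by auto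
  moreover from this have "g' ** g = mat 1" by (rule matrix_left_right_inverse[THEN iffD1])
  ultimately interpret frame g g' by unfold_locales
  have "coords h $ i $ j = 0" if h: "h \<in> H" and ij: "i \<noteq> j" for h i j
  proof -
    have "b j \<in> eigvecs H" using b B(1) by (auto simp: bij_betw_def)
    then obtain c where c: "h *v b j = c *s b j" using h by (auto simp: eigvecs_def)
    have "column j (A ** g) = A *v b j" for A
      by (simp add: vec_eq_iff column_def matrix_mult_nth matrix_vector_mult_def g_def)
    then have "column j (coords h) = g' *v (h *v b j)"
      unfolding coords_def by (simp add: matrix_vector_mul_assoc)
    also have "\<dots> = c *s (g' *v b j)" by (simp add: c vec.scale)
    also have "g' *v b j = column j (mat 1)"
      using \<open>\<And>A. column j (A ** g) = A *v b j\<close>[of g'] left_inv by simp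
    finally have "column j (coords h) $ i = c * column j (mat 1) $ i" by simp
    then show ?thesis using ij by (simp add: column_def mat_def)
  qed
  then show ?thesis using frame_axioms by blast
qed

lemma ex_lie_nonzero: "\<exists>x\<in>sl3. \<exists>y\<in>sl3. lie x y \<noteq> (0 :: 'a::field^3^3)"
proof -
  define E :: "3 \<Rightarrow> 3 \<Rightarrow> 'a^3^3" where "E = (\<lambda>p q. \<chi> i j. if i = p \<and> j = q then 1 else 0)"
  have "lie (E 1 2) (E 2 1) $ 1 $ 1 = 1"
    by (simp add: lie_def E_def matrix_mult_nth sum_3)
  then have "lie (E 1 2) (E 2 1) \<noteq> 0" by auto
  moreover have "E 1 2 \<in> sl3" "E 2 1 \<in> sl3" by (simp_all add: sl3_def E_def mtrace_3)
  ultimately show ?thesis by blast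
qed

text \<open>Otherwise \<open>H\<close> would commute with all of \<open>sl3\<close>. Being
  self-normalizing, it would contain \<open>sl3\<close>, which is not abelian.\<close>

lemma ex_nonzero_root:
  assumes "classical_cartan H"
  shows "\<exists>\<alpha> x h. x \<in> root_space H \<alpha> \<and> x \<noteq> 0 \<and> h \<in> H \<and> \<alpha> h \<noteq> 0"
proof (rule ccontr)
  assume no: "\<not> ?thesis"
  have dec: "is_dsum sl3 {\<alpha>. lin_fun H \<alpha>} (root_space H)" and norm: "normalizer H = H"
    and ab: "lie_abelian H" and "0 \<in> H"
    using assms by (auto simp: classical_cartan_def cartan_def lie_subalg_def subspace_of_def)
  have "lie x h = 0" if "x \<in> sl3" "h \<in> H" for x h
  proof -
    obtain f where f: "\<And>\<alpha>. f \<alpha> \<noteq> 0 \<Longrightarrow> f \<alpha> \<in> root_space H \<alpha>"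
      "x = (\<Sum>\<alpha>\<in>{\<alpha>. f \<alpha> \<noteq> 0}. f \<alpha>)"
      using is_dsum_decompose[OF dec \<open>x \<in> sl3\<close>] by blast
    have "lie (f \<alpha>) h = 0" if "f \<alpha> \<noteq> 0" for \<alpha>
    proof -
      have "f \<alpha> \<in> root_space H \<alpha>" using that by (rule f(1))
      moreover from this have "\<alpha> h = 0" using no that \<open>h \<in> H\<close> by blast
      ultimately show ?thesis using \<open>h \<in> H\<close> by (simp add: root_space_def smul_def vec_eq_iff)
    qed
    moreover have "lie (\<Sum>i\<in>I. f i) h = (\<Sum>i\<in>I. lie (f i) h)" for I
      by (induction I rule: infinite_finite_induct)
        (auto simp: lie_def matrix_add_ldistrib matrix_add_rdistrib)
    ultimately show ?thesis unfolding f(2) by simp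
  qed
  then have "sl3 \<subseteq> H" using norm \<open>0 \<in> H\<close> by (auto simp: normalizer_def)
  then show False using ab ex_lie_nonzero unfolding lie_abelian_def by blast
qed

lemma classical_cartan_is_torus:
  fixes H :: "('a::field^3^3) set"
  assumes "CHAR('a) > 3" "classical_cartan H"
  shows "\<exists>g g'. frame g g' \<and> H = frame.torus g g'"
proof -
  note nz = numerals_nonzero[OF assms(1)]
  have dec: "is_dsum sl3 {\<alpha>. lin_fun H \<alpha>} (root_space H)" and norm: "normalizer H = H"
    and ab: "lie_abelian H" and sub: "H \<subseteq> sl3" "0 \<in> H"
    using assms(2) by (auto simp: classical_cartan_def cartan_def lie_subalg_def subspace_of_def)
  obtain \<alpha> x h where x: "x \<in> root_space H \<alpha>" "x \<noteq> 0" "h \<in> H" "\<alpha> h \<noteq> 0"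
    using ex_nonzero_root[OF assms(2)] by blast
  have "\<exists>v\<in>eigvecs H. v \<noteq> 0"
  proof (rule ex_eigvec[OF nz x(2) _ _ x(3)])
    show "mtrace x = 0" "\<And>h. h \<in> H \<Longrightarrow> lie x h = smul (\<alpha> h) x"
      using x(1) by (simp_all add: root_space_def sl3_def)
    show "\<alpha> h \<noteq> 0" by fact
  qed
  then have "vec.span (eigvecs H) = UNIV" using span_eigvecs[OF nz(2) dec] by blast
  from ex_eigvec_frame[OF this] obtain g g' where fr: "frame g g'"
    and d: "\<forall>h\<in>H. \<forall>i j. i \<noteq> j \<longrightarrow> frame.coords g g' h $ i $ j = 0"
    by (elim exE conjE)
  interpret frame g g' by fact
  have "H \<subseteq> torus" using d sub by (auto simp: torus_def)
  \<comment> \<open>The torus is abelian and contains \<open>H\<close>, so it centralizes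
    \<open>H\<close>; self-normalization then gives equality.\<close>
  moreover have "torus \<subseteq> normalizer H"
  proof
    fix x assume x: "x \<in> torus"
    have "lie x h = 0" if "h \<in> H" for h
      using torus_abelian x \<open>H \<subseteq> torus\<close> that unfolding lie_abelian_def by blast
    then show "x \<in> normalizer H"
      using x sub(2) by (simp add: normalizer_def torus_def)
  qed
  ultimately have "H = torus" using norm by blast
  then show ?thesis using fr by blast
qed

section \<open>Orthogonal tori and cube roots of unity\<close>

text \<open>Both \<open>r\<close> and \<open>s\<close> have vanishing sum, so the \<open>r j\<close> are the roots of some \<open>X\<^sup>3 - c\<close>.\<close>
lemma cube_root_of_reciprocal_sums:
  fixes r s :: "3 \<Rightarrow> 'a::field"
  assumes "(3::'a) \<noteq> 0" and rs: "\<And>j. r j * s j = 1"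
    and r: "r 1 + r 2 + r 3 = 0" and s: "s 1 + s 2 + s 3 = 0"
  shows "\<exists>\<omega>::'a. \<omega> ^ 3 = 1 \<and> \<omega> \<noteq> 1"
proof (intro exI conjI)
  note p = rs[of 1] rs[of 2] rs[of 3]
  show "(r 1 * s 2) ^ 3 = 1"
    using p r s by algebra
  show "r 1 * s 2 \<noteq> 1"
  proof
    \<comment> \<open>This forces \<open>r 1 = r 2\<close> and \<open>s 1 = s 2\<close>, hence
      \<open>r 3 * s 3 = 4\<close>; but the product is 1, so 3 would be zero.\<close>
    assume eq: "r 1 * s 2 = 1"
    have "r 1 = r 2" "s 1 = s 2" using p eq by algebra+
    moreover have "r 3 = - (r 1 + r 2)" "s 3 = - (s 1 + s 2)"
      using r s by (simp_all only: add_eq_0_iff)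
    ultimately have "r 3 * s 3 = 4 * (r 1 * s 1)" by (simp add: algebra_simps)
    then have "(4::'a) - 1 = 0" unfolding rs by simp
    then show False using assms(1) by simp
  qed
qed

text \<open>Testing orthogonality on one traceless diagonal matrix per basis vector fixes every
  product \<open>M $ i $ j * N $ j $ i\<close>, where \<open>M\<close> is the transition matrix
  between the bases and \<open>N\<close> its inverse.\<close>

lemma orthogonal_tori_cube_root:
  fixes g g' k k' :: "'a::field^3^3"
  assumes nz: "(2::'a) \<noteq> 0" "(3::'a) \<noteq> 0"
    and "frame g g'" "frame k k'"
    and orth: "\<forall>x\<in>frame.torus g g'. \<forall>y\<in>frame.torus k k'. killing x y = 0"
  shows "\<exists>\<omega>::'a. \<omega> ^ 3 = 1 \<and> \<omega> \<noteq> 1"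
proof -
  interpret G: frame g g' by fact
  interpret K: frame k k' by fact
  define M where "M = g' ** k"
  define N where "N = k' ** g"
  have MN: "M ** N = mat 1"
    unfolding M_def N_def by (simp add: matrix_mul_assoc K.cancel_inv G.left_inv)
  have NM: "N ** M = mat 1"
    unfolding M_def N_def by (simp add: matrix_mul_assoc G.cancel_inv K.left_inv)
  \<comment> \<open>Three times a diagonal matrix unit minus the identity: traceless, and sensitive
    to a single basis vector.\<close>
  define P :: "3 \<Rightarrow> 'a^3^3" where "P = (\<lambda>i. \<chi> p q. if p = q then (if p = i then 3 else 0) - 1 else 0)"
  have c: "M $ i $ j * N $ j $ i = 1 / 3" for i j
  proof -
    define x where "x = g ** P i ** g'"
    define y where "y = k ** P j ** k'"
    have "x \<in> G.torus"
      by (auto simp: G.torus_def G.coords_sl3_iff x_def P_def sum_subtractf)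
    moreover have "y \<in> K.torus"
      by (auto simp: K.torus_def K.coords_sl3_iff y_def P_def sum_subtractf)
    ultimately have "killing x y = 0" using orth by blast
    moreover have "(of_nat (2 * 3) :: 'a) \<noteq> 0"
      using nz by (metis mult_eq_0_iff of_nat_mult of_nat_numeral)
    ultimately have "mtrace (x ** y) = 0" unfolding killing_def by (metis mult_eq_0_iff)
    have "mtrace (x ** y) = mtrace (g ** (P i ** M ** P j ** k'))"
      by (simp add: x_def y_def M_def matrix_mul_assoc)
    also have "\<dots> = mtrace (P i ** M ** P j ** k' ** g)"
      by (rule mtrace_mult_commute)
    also have "\<dots> = mtrace ((P i ** M) ** (P j ** N))"
      by (simp add: N_def matrix_mul_assoc)
    also have "\<dots> = (\<Sum>p\<in>UNIV. \<Sum>q\<in>UNIV. ((if p = i then 3 else 0) - 1) * ((if q = j then 3 else 0) - 1) * (M $ p $ q * N $ q $ p))"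
    proof -
      have Pm: "(P i ** A) $ p $ q = ((if p = i then 3 else 0) - 1) * A $ p $ q" for i A p q
        unfolding matrix_mult_nth P_def by (simp add: if_distribR if_distrib[of "\<lambda>x. x * _"] cong: if_cong)
      show ?thesis
        unfolding mtrace_def matrix_mult_nth[of "P i ** M"] Pm
        by (intro sum.cong refl) (simp only: mult_ac)
    qed
    \<comment> \<open>Expanding the two factors isolates one product. The remaining terms are
      diagonal entries of \<open>M ** N\<close> and \<open>N ** M\<close> and a trace, contributing
      -3, -3 and 3.\<close>
    also have "\<dots> = 9 * (M $ i $ j * N $ j $ i) - 3 * (\<Sum>q\<in>UNIV. M $ i $ q * N $ q $ i)
        - 3 * (\<Sum>p\<in>UNIV. N $ j $ p * M $ p $ j) + (\<Sum>p\<in>UNIV. \<Sum>q\<in>UNIV. M $ p $ q * N $ q $ p)"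
      using exhaust_3[of i] exhaust_3[of j]
      by (elim disjE) (simp_all add: sum_3 algebra_simps)
    also have "\<dots> = 9 * (M $ i $ j * N $ j $ i) - 3 * (M ** N) $ i $ i - 3 * (N ** M) $ j $ j
        + (\<Sum>p\<in>UNIV. (M ** N) $ p $ p)"
      by (simp add: matrix_mult_nth)
    also have "\<dots> = 9 * (M $ i $ j * N $ j $ i) - 3"
      by (simp add: MN NM mat_def)
    finally have "9 * (M $ i $ j * N $ j $ i) - 3 = 0"
      using \<open>mtrace (x ** y) = 0\<close> by simp
    then have "3 * (3 * (M $ i $ j * N $ j $ i) - 1) = 0" by (simp add: algebra_simps)
    then have "3 * (M $ i $ j * N $ j $ i) - 1 = 0" using nz(2) by (metis mult_eq_0_iff)
    then show ?thesis using nz(2) by (simp add: field_simps)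
  qed
  \<comment> \<open>By \<open>c\<close> these are the quotients of rows 1 and 2 of \<open>M\<close>
    and their inverses; their sums are off-diagonal entries of \<open>M ** N\<close>, up to the
    factor 3.\<close>
  define r where "r = (\<lambda>j. 3 * (M $ 1 $ j * N $ j $ 2))"
  define s where "s = (\<lambda>j. 3 * (M $ 2 $ j * N $ j $ 1))"
  show ?thesis
  proof (rule cube_root_of_reciprocal_sums[OF nz(2)])
    show "r j * s j = 1" for j
    proof -
      have "r j * s j = (3 * (M $ 1 $ j * N $ j $ 1)) * (3 * (M $ 2 $ j * N $ j $ 2))"
        by (simp add: r_def s_def)
      then show ?thesis unfolding c using nz(2) by simp
    qed
    have "r 1 + r 2 + r 3 = 3 * (M ** N) $ 1 $ 2" "s 1 + s 2 + s 3 = 3 * (M ** N) $ 2 $ 1"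
      by (simp_all add: r_def s_def matrix_mult_nth sum_3 distrib_left)
    then show "r 1 + r 2 + r 3 = 0" "s 1 + s 2 + s 3 = 0"
      by (simp_all add: MN mat_def)
  qed
qed

lemma COD_imp_cube_root:
  assumes "CHAR('a::field) > 3" "sl3_has_COD TYPE('a)"
  shows "\<exists>\<omega>::'a. \<omega> ^ 3 = 1 \<and> \<omega> \<noteq> 1"
proof -
  obtain H :: "nat \<Rightarrow> ('a^3^3) set" where H: "\<forall>i\<le>3. classical_cartan (H i)"
    and orth: "\<forall>i\<le>3. \<forall>j\<le>3. i \<noteq> j \<longrightarrow> (\<forall>x\<in>H i. \<forall>y\<in>H j. killing x y = 0)"
    using assms(2) unfolding sl3_has_COD_def by (elim exE conjE)
  have "classical_cartan (H 0)" "classical_cartan (H 1)" using H by simp_all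
  from this[THEN classical_cartan_is_torus[OF assms(1)]]
  obtain g g' k k' where fr: "frame g g'" "frame k k'" and eq: "H 0 = frame.torus g g'" "H 1 = frame.torus k k'"
    by (elim exE conjE)
  have "\<forall>x\<in>H 0. \<forall>y\<in>H 1. killing x y = 0"
    by (intro ballI, rule orth[rule_format, of 0 1]) simp_all
  then show ?thesis
    unfolding eq by (rule orthogonal_tori_cube_root[OF numerals_nonzero[OF assms(1)] fr])
qed

section \<open>The decomposition from generalized Pauli matrices\<close>

text \<open>For \<open>t\<^sup>3 = 1\<close>, the matrices \<open>cyc t a b\<close> are the combinations of \<open>X\<close> and \<open>X\<^sup>2\<close> for a monomial
  matrix \<open>X\<close> with \<open>X\<^sup>3 = 1\<close>; the columns of \<open>mub w t\<close> are eigenvectors of \<open>X\<close>. For \<open>t = w\<^sup>i\<close> the entry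
  of \<open>mub w t\<close> at \<open>(x, j)\<close> is \<open>w\<close> to the power \<open>i x\<^sup>2 + j x\<close>, the index 3 standing for 0.\<close>
definition cyc :: "'a::field \<Rightarrow> 'a \<Rightarrow> 'a \<Rightarrow> 'a^3^3" where
  "cyc t a b = vector [vector [0, b, t * a], vector [a, 0, t * b], vector [t^2 * b, t^2 * a, 0]]"

definition mub :: "'a::field \<Rightarrow> 'a \<Rightarrow> 'a^3^3" where
  "mub w t = vector [vector [t * w, t * w^2, t], vector [t * w^2, t * w, t], vector [1, 1, 1]]"

definition mub_inv :: "'a::field \<Rightarrow> 'a \<Rightarrow> 'a^3^3" where
  "mub_inv w t = smul (1 / 3) (vector [vector [t^2 * w^2, t^2 * w, 1], vector [t^2 * w, t^2 * w^2, 1],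
     vector [t^2, t^2, 1]])"

lemma matrix_eq_3:
  "A = B \<longleftrightarrow> (\<forall>i\<in>{1,2,3}. \<forall>j\<in>{1,2,3}. A $ i $ j = (B :: 'a^3^3) $ i $ j)"
  by (simp add: vec_eq_iff forall_3)

text \<open>Primitivity is given as a polynomial equation, so that entrywise identities can be
  decided modulo it; together with \<open>3 \<noteq> 0\<close> it excludes
  \<open>w = 1\<close>.\<close>

context
  fixes w :: "'a::field"
  assumes nz3: "(3::'a) \<noteq> 0" and w: "w^2 + w + 1 = 0"
begin

lemma frame_mub:
  assumes t: "t ^ 3 = 1"
  shows "frame (mub w t) (mub_inv w t)"
proof -
  \<comment> \<open>Pulling out the factor \<open>1 / 3\<close> leaves polynomial identities modulo
    the equations for \<open>w\<close> and \<open>t\<close>.\<close>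
  have "mub w t ** mub_inv w t = smul (1 / 3) (smul 3 (mat 1))"
    unfolding mub_inv_def smul_mult_right
    by (rule arg_cong[where f = "smul (1 / 3)"], unfold matrix_eq_3 mub_def)
      (simp add: matrix_mult_nth sum_3 mat_def; intro conjI; use w t in algebra)
  also have "\<dots> = mat 1" using nz3 by (intro matrix_eqI) simp
  finally have "mub w t ** mub_inv w t = mat 1" .
  moreover from this have "mub_inv w t ** mub w t = mat 1"
    by (rule matrix_left_right_inverse[THEN iffD1])
  ultimately show ?thesis by unfold_locales
qed

lemma torus_mub:
  assumes t: "t ^ 3 = 1"
  shows "frame.torus (mub w t) (mub_inv w t) = {cyc t a b |a b. True}"
proof -
  interpret frame "mub w t" "mub_inv w t" by (rule frame_mub[OF t])
  show ?thesis
  proof (intro equalityI subsetI)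
    fix x assume x: "x \<in> torus"
    define D where "D = coords x"
    define d where "d = (\<lambda>i. D $ i $ i)"
    have cx: "D $ i $ j = (if i = j then d i else 0)" for i j
      using x by (auto simp: torus_def d_def D_def)
    have d0: "d 1 + d 2 + d 3 = 0"
      using x by (simp add: torus_def coords_sl3_iff sum_3 d_def D_def)
    \<comment> \<open>These are the nonconstant Fourier coefficients of the diagonal
      \<open>d\<close>; the constant one vanishes by \<open>d0\<close>.\<close>
    define a where "a = (d 1 * w + d 2 * w^2 + d 3) / 3"
    define b where "b = (d 1 * w^2 + d 2 * w + d 3) / 3"
    have ab: "3 * a = d 1 * w + d 2 * w^2 + d 3" "3 * b = d 1 * w^2 + d 2 * w + d 3"
      using nz3 by (simp_all add: a_def b_def)
    have "x = mub w t ** D ** mub_inv w t"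
      unfolding D_def by (rule of_coords[symmetric])
    also have "\<dots> = smul (1 / 3) (smul 3 (cyc t a b))"
      unfolding mub_inv_def smul_mult_right
      by (rule arg_cong[where f = "smul (1 / 3)"], unfold matrix_eq_3 mub_def cyc_def)
        (simp add: matrix_mult_nth sum_3 cx; intro conjI; use w t d0 ab in algebra)
    also have "\<dots> = cyc t a b" using nz3 by (intro matrix_eqI) simp
    finally show "x \<in> {cyc t a b |a b. True}" by blast
  next
    fix x assume "x \<in> {cyc t a b |a b. True}"
    then obtain a b where x: "x = cyc t a b" by blast
    let ?V = "vector [vector [t^2 * w^2, t^2 * w, 1], vector [t^2 * w, t^2 * w^2, 1],
      vector [t^2, t^2, 1]] :: 'a^3^3"
    have "\<forall>i j. i \<noteq> j \<longrightarrow> (?V ** cyc t a b ** mub w t) $ i $ j = 0"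
      unfolding forall_3 mub_def cyc_def
      by (simp add: matrix_mult_nth sum_3; intro conjI; use w t in algebra)
    moreover have "coords x = smul (1 / 3) (?V ** cyc t a b ** mub w t)"
      unfolding coords_def x by (simp add: mub_inv_def smul_mult_left)
    ultimately have "\<forall>i j. i \<noteq> j \<longrightarrow> coords x $ i $ j = 0" by simp
    moreover have "x \<in> sl3" by (simp add: sl3_def x cyc_def mtrace_3)
    ultimately show "x \<in> torus" by (simp add: torus_def)
  qed
qed

text \<open>Modulo \<open>u ^ 3 = 1\<close> the trace of the product is
  \<open>(a * d + b * c) * u * (t^2 + t * u + u^2)\<close>, and the last factor vanishes for
  distinct cube roots of unity.\<close>

lemma cyc_orthogonal:
  assumes "t ^ 3 = 1" "u ^ 3 = 1" "t \<noteq> u"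
  shows "killing (cyc t a b) (cyc u c d) = 0"
proof -
  have "(t - u) * (t^2 + t * u + u^2) = 0"
    using assms(1,2) by algebra
  then have "t^2 + t * u + u^2 = 0" using assms(3) by simp
  then have "mtrace (cyc t a b ** cyc u c d) = 0"
    using assms(1,2) unfolding mtrace_3 cyc_def
    by (simp add: matrix_mult_nth sum_3) algebra
  then show ?thesis by (simp add: killing_def)
qed

lemma cube_w: "w ^ 3 = 1" using w by algebra

text \<open>Inversion of the three-point Fourier transform: in each combination two of
  \<open>p\<close>, \<open>q\<close>, \<open>r\<close> cancel by \<open>w^2 + w + 1 = 0\<close>,
  leaving three times the third.\<close>

lemma fourier_inversion:
  fixes a b c :: 'a
  assumes "3 * a = p + w^2 * q + w * r" "3 * b = p + w * q + w^2 * r" "3 * c = p + q + r"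
  shows "a + b + c = p" "w * a + w^2 * b + c = q" "w^2 * a + w * b + c = r"
proof -
  have "3 * (a + b + c) = 3 * a + 3 * b + 3 * c" by (simp add: algebra_simps)
  also have "\<dots> = 3 * p" unfolding assms using w by algebra
  finally show "a + b + c = p" using nz3 by (metis mult_left_cancel)
  have "3 * (w * a + w^2 * b + c) = w * (3 * a) + w^2 * (3 * b) + 3 * c" by (simp add: algebra_simps)
  also have "\<dots> = 3 * q" unfolding assms using w by algebra
  finally show "w * a + w^2 * b + c = q" using nz3 by (metis mult_left_cancel)
  have "3 * (w^2 * a + w * b + c) = w^2 * (3 * a) + w * (3 * b) + 3 * c" by (simp add: algebra_simps)
  also have "\<dots> = 3 * r" unfolding assms using w by algebra
  finally show "w^2 * a + w * b + c = r" using nz3 by (metis mult_left_cancel)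
qed

lemma fourier_injective:
  fixes a b c :: 'a
  assumes "a + b + c = 0" "w * a + w^2 * b + c = 0" "w^2 * a + w * b + c = 0"
  shows "a = 0 \<and> b = 0 \<and> c = 0"
proof -
  have "3 * a = (a + b + c) + w^2 * (w * a + w^2 * b + c) + w * (w^2 * a + w * b + c)"
    using w by algebra
  moreover have "3 * b = (a + b + c) + w * (w * a + w^2 * b + c) + w^2 * (w^2 * a + w * b + c)"
    using w by algebra
  moreover have "3 * c = (a + b + c) + (w * a + w^2 * b + c) + (w^2 * a + w * b + c)"
    using w by algebra
  ultimately have "3 * a = 0" "3 * b = 0" "3 * c = 0" unfolding assms by simp_all
  then show ?thesis using nz3 by simp
qed

text \<open>At the positions \<open>(2,1)\<close>, \<open>(1,3)\<close>, \<open>(3,2)\<close> the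
  matrix \<open>cyc t a b\<close> has entries \<open>a\<close>, \<open>t * a\<close>,
  \<open>t^2 * a\<close>. With \<open>t\<close> running over the cube roots of unity this is a
  Fourier system for the \<open>a\<close>'s; the transposed positions give one for the
  \<open>b\<close>'s.\<close>

lemma diag_cyc_independent:
  assumes d: "\<forall>i j. i \<noteq> j \<longrightarrow> d $ i $ j = 0"
    and z: "d + cyc w a1 b1 + cyc (w^2) a2 b2 + cyc 1 a3 b3 = 0"
  shows "d = 0 \<and> a1 = 0 \<and> b1 = 0 \<and> a2 = 0 \<and> b2 = 0 \<and> a3 = 0 \<and> b3 = 0"
proof -
  have z': "(d + cyc w a1 b1 + cyc (w^2) a2 b2 + cyc 1 a3 b3) $ i $ j = 0" for i j
    using z by simp
  have w4: "w ^ 4 = w" using cube_w by algebra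
  have "a1 = 0 \<and> a2 = 0 \<and> a3 = 0"
    by (rule fourier_injective) (use z'[of 2 1] z'[of 1 3] z'[of 3 2] d in \<open>simp_all add: cyc_def w4\<close>)
  moreover have "b1 = 0 \<and> b2 = 0 \<and> b3 = 0"
    by (rule fourier_injective) (use z'[of 1 2] z'[of 2 3] z'[of 3 1] d in \<open>simp_all add: cyc_def w4\<close>)
  moreover have "cyc t 0 0 = 0" for t :: 'a
    by (simp add: vec_eq_iff forall_3 cyc_def)
  ultimately show ?thesis using z by simp
qed

lemma diag_cyc_spanning:
  assumes "x \<in> sl3"
  shows "\<exists>d a1 b1 a2 b2 a3 b3. d \<in> sl3 \<and> (\<forall>i j. i \<noteq> j \<longrightarrow> d $ i $ j = 0)
    \<and> x = d + cyc w a1 b1 + cyc (w^2) a2 b2 + cyc 1 a3 b3"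
proof -
  \<comment> \<open>The inverse Fourier transform of the off-diagonal entries, with
    \<open>t^2\<close> and \<open>t\<close> serving as inverses of \<open>t\<close> and
    \<open>t^2\<close>.\<close>
  define a where "a = (\<lambda>t. (x$2$1 + t^2 * x$1$3 + t * x$3$2) / 3)"
  define b where "b = (\<lambda>t. (x$1$2 + t^2 * x$2$3 + t * x$3$1) / 3)"
  define d where "d = (\<chi> i j. if i = j then x $ i $ i else 0)"
  have ab: "3 * a t = x$2$1 + t^2 * x$1$3 + t * x$3$2" "3 * b t = x$1$2 + t^2 * x$2$3 + t * x$3$1" for t
    using nz3 by (simp_all add: a_def b_def)
  have w4: "w ^ 4 = w" using cube_w by algebra
  have A: "a w + a (w^2) + a 1 = x$2$1" "w * a w + w^2 * a (w^2) + a 1 = x$1$3"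
    "w^2 * a w + w * a (w^2) + a 1 = x$3$2"
    by (rule fourier_inversion; simp add: ab w4)+
  have B: "b w + b (w^2) + b 1 = x$1$2" "w * b w + w^2 * b (w^2) + b 1 = x$2$3"
    "w^2 * b w + w * b (w^2) + b 1 = x$3$1"
    by (rule fourier_inversion; simp add: ab w4)+
  have "x = d + cyc w (a w) (b w) + cyc (w^2) (a (w^2)) (b (w^2)) + cyc 1 (a 1) (b 1)"
    unfolding vec_eq_iff forall_3 by (simp add: d_def cyc_def w4 A B)
  moreover have "d \<in> sl3" using assms by (simp add: sl3_def mtrace_def d_def)
  moreover have "\<forall>i j. i \<noteq> j \<longrightarrow> d $ i $ j = 0" by (simp add: d_def)
  ultimately show ?thesis by blast
qed

lemma killing_diag_cyc:
  assumes "\<forall>i j. i \<noteq> j \<longrightarrow> d $ i $ j = 0"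
  shows "killing d (cyc t a b) = 0" "killing (cyc t a b) d = 0"
  using assms by (simp_all add: killing_def mtrace_3 matrix_mult_nth sum_3 cyc_def)

lemma cyc_diff: "cyc t a b - cyc t c d = cyc t (a - c) (b - d)"
  by (simp add: vec_eq_iff forall_3 cyc_def algebra_simps)

text \<open>Index 0 is the standard diagonal torus. Indices 1, 2, 3 run through the cube roots of
  unity \<open>w\<close>, \<open>w^2\<close> and \<open>w^3 = 1\<close>.\<close>

definition pauli :: "nat \<Rightarrow> ('a^3^3) set" where
  "pauli i = (if i = 0 then frame.torus (mat 1) (mat 1)
     else frame.torus (mub w (w ^ i)) (mub_inv w (w ^ i)))"

lemma pow_w: "(w ^ i) ^ 3 = 1"
  by (metis cube_w mult.commute power_mult power_one)

lemma frame_one: "frame (mat 1) (mat 1 :: 'a^3^3)"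
  by unfold_locales simp_all

lemma pauli_eq:
  "pauli 0 = {d \<in> sl3. \<forall>i j. i \<noteq> j \<longrightarrow> d $ i $ j = 0}"
  "i \<noteq> 0 \<Longrightarrow> pauli i = {cyc (w ^ i) a b |a b. True}"
proof -
  interpret frame "mat 1" "mat 1 :: 'a^3^3" by (rule frame_one)
  show "pauli 0 = {d \<in> sl3. \<forall>i j. i \<noteq> j \<longrightarrow> d $ i $ j = 0}"
    by (simp add: pauli_def torus_def coords_def)
  show "pauli i = {cyc (w ^ i) a b |a b. True}" if "i \<noteq> 0"
    using torus_mub[OF pow_w] that by (simp add: pauli_def)
qed

lemma classical_cartan_pauli:
  assumes "CHAR('a) > 3"
  shows "classical_cartan (pauli i)"
  unfolding pauli_def
  using frame.classical_cartan_torus[OF frame_one assms]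
    frame.classical_cartan_torus[OF frame_mub[OF pow_w] assms] by simp

lemma pow_w_distinct:
  assumes "i \<in> {1,2,3}" "j \<in> {1,2,3}" "i \<noteq> (j::nat)"
  shows "w ^ i \<noteq> w ^ j"
proof -
  have "w \<noteq> 1" using w nz3 by auto
  moreover from this have "w^2 \<noteq> 1" "w \<noteq> w^2"
    using cube_w by (auto simp: power2_eq_square power3_eq_cube)
  ultimately show ?thesis using assms cube_w by auto
qed

lemma pauli_orthogonal:
  assumes "i \<le> 3" "j \<le> 3" "i \<noteq> j" "x \<in> pauli i" "y \<in> pauli j"
  shows "killing x y = 0"
proof (cases "i = 0 \<or> j = 0")
  case True
  then show ?thesis
    using assms pauli_eq killing_diag_cyc by (cases "i = 0") auto
next
  case False
  then have "i \<in> {1,2,3}" "j \<in> {1,2,3}" using assms by auto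
  then have "w ^ i \<noteq> w ^ j" using assms(3) by (rule pow_w_distinct)
  then show ?thesis
    using assms(4,5) False pauli_eq(2)[of i] pauli_eq(2)[of j] cyc_orthogonal[OF pow_w pow_w] by auto
qed

lemma pauli_dsum: "is_dsum sl3 {0..3} pauli"
  unfolding is_dsum_def
proof (intro conjI ballI)
  show "subspace_of sl3 (pauli i)" for i
    unfolding pauli_def
    using frame.torus_subspace[OF frame_one] frame.torus_subspace[OF frame_mub[OF pow_w]] by simp
next
  fix x :: "'a^3^3" assume x: "x \<in> sl3"
  let ?C = "\<lambda>f. (\<forall>i. f i \<in> (if i \<in> {0..3} then pauli i else {0})) \<and> finite {i. f i \<noteq> 0}
    \<and> x = (\<Sum>i\<in>{i. f i \<noteq> 0}. f i)"
  \<comment> \<open>The index type is all of \<open>nat\<close>, so the sum over the support is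
    first reduced to its four possible terms.\<close>
  have sum4: "(\<Sum>i\<in>{i. f i \<noteq> 0}. f i) = f 0 + f 1 + f 2 + f 3"
    if "\<And>i. i > 3 \<Longrightarrow> f i = 0" for f :: "nat \<Rightarrow> 'a^3^3"
  proof -
    have "(\<Sum>i\<in>{i. f i \<noteq> 0}. f i) = (\<Sum>i\<in>{0..3}. f i)"
      by (rule sum.mono_neutral_left) (use that in \<open>force simp flip: not_less\<close>)+
    also have "\<dots> = f 0 + f 1 + f 2 + f 3" by (simp add: numeral_eq_Suc)
    finally show ?thesis .
  qed
  show "\<exists>!f. ?C f"
  proof (rule ex_ex1I)
    obtain d a1 b1 a2 b2 a3 b3 where d: "d \<in> sl3" "\<forall>i j. i \<noteq> j \<longrightarrow> d $ i $ j = 0"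
      and eq: "x = d + cyc w a1 b1 + cyc (w^2) a2 b2 + cyc 1 a3 b3"
      using diag_cyc_spanning[OF x] by blast
    define f :: "nat \<Rightarrow> 'a^3^3" where
      "f = (\<lambda>_. 0)(0 := d, 1 := cyc w a1 b1, 2 := cyc (w^2) a2 b2, 3 := cyc 1 a3 b3)"
    have f_simps: "f 0 = d" "f 1 = cyc w a1 b1" "f 2 = cyc (w^2) a2 b2" "f 3 = cyc 1 a3 b3"
      by (simp_all add: f_def)
    have f_big: "f i = 0" if "i > 3" for i using that by (simp add: f_def)
    have "f i \<in> (if i \<in> {0..3} then pauli i else {0})" for i
    proof (cases "i > 3")
      case True
      then show ?thesis by (simp add: f_big)
    next
      case False
      then have "i = 0 \<or> i = 1 \<or> i = 2 \<or> i = 3" by auto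
      moreover have "d \<in> pauli 0" using d by (simp add: pauli_eq)
      moreover have "cyc w a1 b1 \<in> pauli 1" "cyc (w^2) a2 b2 \<in> pauli 2" "cyc 1 a3 b3 \<in> pauli 3"
        using pauli_eq(2)[of 1] pauli_eq(2)[of 2] pauli_eq(2)[of 3] cube_w by auto
      ultimately show ?thesis using f_simps by auto
    qed
    moreover have "finite {i. f i \<noteq> 0}"
      by (rule finite_subset[of _ "{0..3}"]) (use f_big in \<open>force simp flip: not_less\<close>, simp)
    moreover have "x = (\<Sum>i\<in>{i. f i \<noteq> 0}. f i)"
      using sum4[OF f_big] eq f_simps by simp
    ultimately show "\<exists>f. ?C f" by blast
  next
    have parts: "(\<forall>i>3. f i = 0) \<and> f 0 \<in> pauli 0 \<and> x = f 0 + f 1 + f 2 + f 3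
        \<and> (\<exists>a b. f 1 = cyc w a b) \<and> (\<exists>a b. f 2 = cyc (w^2) a b) \<and> (\<exists>a b. f 3 = cyc 1 a b)"
      if C: "?C f" for f
    proof -
      have big: "f i = 0" if "i > 3" for i
        using C that by (auto dest!: spec[of _ i])
      have mem: "f i \<in> pauli i" if "i \<le> 3" for i
        using C that by (auto dest!: spec[of _ i])
      show ?thesis
        using big mem[of 0] mem[of 1] mem[of 2] mem[of 3] C sum4[OF big]
          pauli_eq(2)[of 1] pauli_eq(2)[of 2] pauli_eq(2)[of 3] cube_w by auto
    qed
    fix f h assume f: "?C f" and h: "?C h"
    obtain a1 b1 a2 b2 a3 b3 where
      fp: "f 1 = cyc w a1 b1" "f 2 = cyc (w^2) a2 b2" "f 3 = cyc 1 a3 b3"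
      using parts[OF f] by (elim conjE exE)
    obtain c1 d1 c2 d2 c3 d3 where
      hp: "h 1 = cyc w c1 d1" "h 2 = cyc (w^2) c2 d2" "h 3 = cyc 1 c3 d3"
      using parts[OF h] by (elim conjE exE)
    have "x = f 0 + f 1 + f 2 + f 3" using parts[OF f] by (elim conjE)
    moreover have "x = h 0 + h 1 + h 2 + h 3" using parts[OF h] by (elim conjE)
    ultimately have "f 0 + f 1 + f 2 + f 3 = h 0 + h 1 + h 2 + h 3" by simp
    \<comment> \<open>The difference of two decompositions again has a diagonal part and three
      \<open>cyc\<close> parts, and independence makes all of them zero.\<close>
    then have "(f 0 - h 0) + (f 1 - h 1) + (f 2 - h 2) + (f 3 - h 3) = 0"
      by (simp add: algebra_simps)
    then have z: "(f 0 - h 0) + cyc w (a1 - c1) (b1 - d1) + cyc (w^2) (a2 - c2) (b2 - d2)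
        + cyc 1 (a3 - c3) (b3 - d3) = 0"
      by (simp only: fp hp cyc_diff)
    have "f 0 \<in> pauli 0" "h 0 \<in> pauli 0" using parts[OF f] parts[OF h] by simp_all
    then have "\<forall>i j. i \<noteq> j \<longrightarrow> (f 0 - h 0) $ i $ j = 0" by (simp add: pauli_eq)
    from diag_cyc_independent[OF this z] have eq: "f 0 = h 0" "f 1 = h 1" "f 2 = h 2" "f 3 = h 3"
      using fp hp by auto
    have big: "f i = h i" if "i > 3" for i using parts[OF f] parts[OF h] that by simp
    show "f = h"
    proof
      fix i :: nat
      have "i = 0 \<or> i = 1 \<or> i = 2 \<or> i = 3 \<or> i > 3" by auto
      then show "f i = h i" using eq big by auto
    qed
  qed
qed

end

theorem theorem3p5:
  assumes "CHAR('a::field) > 3"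
  shows "sl3_has_COD TYPE('a) \<longleftrightarrow> (\<exists>\<omega>::'a. \<omega> ^ 3 = 1 \<and> \<omega> \<noteq> 1)"
proof
  assume "sl3_has_COD TYPE('a)"
  then show "\<exists>\<omega>::'a. \<omega> ^ 3 = 1 \<and> \<omega> \<noteq> 1" by (rule COD_imp_cube_root[OF assms])
next
  assume "\<exists>\<omega>::'a. \<omega> ^ 3 = 1 \<and> \<omega> \<noteq> 1"
  then obtain w :: 'a where "w ^ 3 = 1" "w \<noteq> 1" by blast
  have "(w - 1) * (w^2 + w + 1) = 0" using \<open>w ^ 3 = 1\<close> by algebra
  then have w: "w^2 + w + 1 = 0" using \<open>w \<noteq> 1\<close> by simp
  note nz3 = numerals_nonzero(2)[OF assms]
  show "sl3_has_COD TYPE('a)"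
    unfolding sl3_has_COD_def
    using classical_cartan_pauli[OF nz3 w assms] pauli_orthogonal[OF nz3 w] pauli_dsum[OF nz3 w]
    by (intro exI[of _ "pauli w"]) blast
qed

end
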